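(* Let $\mathcal X$ be a Banach space of analytic functions on the open unit disc $\mathbb D$ such that: for every $\lambda\in\mathbb D$ the evaluation map $f\in\mathcal X\mapsto f(\lambda)\in\mathbb C$ is continuous; $zf\in\mathcal X$ for every $f\in\mathcal X$; and the set $\mathcal P$ of polynomials is (contained and) dense in $\mathcal X$. Let $\mathcal A$ be a commutative unital Banach algebra of functions on $\mathbb D$ such that: $\mathcal A\subset\mathfrak M(\mathcal X)$; for every $\lambda\in\mathbb D$ the evaluation map $f\in\mathcal A\mapsto f(\lambda)\in\mathbb C$ is continuous; and there exist constants $C>0$ and $A\ge 1$ such that for every $\delta>0$ and every $f_1,f_2\in\mathcal A$ satisfying $0<\delta\le |f_1|+|f_2|\le 1$ on $\mathbb D$, there exist $g_1,g_2\in\mathcal A$ with $f_1g_1+f_2g_2\equiv 1$ on $\mathbb D$ and $\|g_1\|_{\mathcal A},\|g_2\|_{\mathcal A}\le C/\delta^{A}$. Then there exists an integer $N\ge 1$ such that for every $f,g\in\mathcal A$ satisfying $|g(z)|\le |f(z)|$ for every $z\in\mathbb D$, we have $$[g^N]_{\mathcal X}\subset [f]_{\mathcal X}.$$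
   Context: $\mathfrak M(\mathcal X)=\{\varphi\in\mathcal X:\varphi f\in\mathcal X \text{ for all } f\in\mathcal X\}$ is the algebra of multipliers of $\mathcal X$. The algebra $\mathcal A$ carries pointwise operations, its unit is the constant function $1$, and it has its own complete norm $\|\cdot\|_{\mathcal A}$. For $f\in\mathcal X$, $[f]_{\mathcal X}$ denotes the closure in $\mathcal X$ of $\{pf:p\in\mathcal P\}$, where $\mathcal P$ is the set of polynomials (in $z$, complex coefficients); it is the smallest closed subspace containing $f$ that is invariant under the shift $S:f(z)\mapsto zf(z)$. *)

theory Defs
  imports "HOL-Complex_Analysis.Complex_Analysis" "HOL-Computational_Algebra.Polynomial"
begin

abbreviation unit_disc :: "complex set" where
  "unit_disc \<equiv> ball 0 1"

text \<open>A function on the disc is represented by its extension by zero to the whole plane. Hence two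
  such functions are equal iff they agree on the disc, and pointwise sums, products and scalar
  multiples are again of this form.\<close>

definition on_disc :: "(complex \<Rightarrow> complex) \<Rightarrow> complex \<Rightarrow> complex" where
  "on_disc f = (\<lambda>z. if z \<in> unit_disc then f z else 0)"

text \<open>\<^locale>\<open>Metric_space\<close> requires nonnegativity and symmetry of the distance also for
  arguments outside the carrier, whereas nothing is assumed about a norm there; hence the guard.\<close>

definition fun_dist :: "(complex \<Rightarrow> complex) set \<Rightarrow> ((complex \<Rightarrow> complex) \<Rightarrow> real) \<Rightarrow>
    (complex \<Rightarrow> complex) \<Rightarrow> (complex \<Rightarrow> complex) \<Rightarrow> real" where
  "fun_dist X nrm f g = (if f \<in> X \<and> g \<in> X then nrm (\<lambda>z. f z - g z) else 0)"

definition fun_topology :: "(complex \<Rightarrow> complex) set \<Rightarrow> ((complex \<Rightarrow> complex) \<Rightarrow> real) \<Rightarrow>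
    (complex \<Rightarrow> complex) topology" where
  "fun_topology X nrm = Metric_space.mtopology X (fun_dist X nrm)"

locale disc_normed_space =
  fixes X :: "(complex \<Rightarrow> complex) set" and nrm :: "(complex \<Rightarrow> complex) \<Rightarrow> real"
  assumes zero_outside: "\<And>f z. f \<in> X \<Longrightarrow> z \<notin> unit_disc \<Longrightarrow> f z = 0"
    and zero_mem: "(\<lambda>z. 0) \<in> X"
    and add_mem: "\<And>f g. f \<in> X \<Longrightarrow> g \<in> X \<Longrightarrow> (\<lambda>z. f z + g z) \<in> X"
    and scale_mem: "\<And>c f. f \<in> X \<Longrightarrow> (\<lambda>z. c * f z) \<in> X"
    and nrm_eq_0: "\<And>f. f \<in> X \<Longrightarrow> nrm f = 0 \<longleftrightarrow> f = (\<lambda>z. 0)"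
    and nrm_scale: "\<And>c f. f \<in> X \<Longrightarrow> nrm (\<lambda>z. c * f z) = cmod c * nrm f"
    and nrm_triangle: "\<And>f g. f \<in> X \<Longrightarrow> g \<in> X \<Longrightarrow> nrm (\<lambda>z. f z + g z) \<le> nrm f + nrm g"
begin

lemma diff_mem: "f \<in> X \<Longrightarrow> g \<in> X \<Longrightarrow> (\<lambda>z. f z - g z) \<in> X"
  using add_mem[of f "\<lambda>z. - 1 * g z"] scale_mem[of g "- 1"] by simp

lemma nrm_minus: "f \<in> X \<Longrightarrow> nrm (\<lambda>z. - f z) = nrm f"
  using nrm_scale[of f "- 1"] by simp

lemma nrm_nonneg: "f \<in> X \<Longrightarrow> 0 \<le> nrm f"
  using nrm_triangle[of f "\<lambda>z. - 1 * f z"] scale_mem[of f "- 1"] nrm_minus[of f]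
    nrm_eq_0[OF zero_mem] by simp

end

sublocale disc_normed_space \<subseteq> Metric_space X "fun_dist X nrm"
proof
  show "0 \<le> fun_dist X nrm f g" for f g
    using nrm_nonneg[OF diff_mem] by (simp add: fun_dist_def)
  show "fun_dist X nrm f g = fun_dist X nrm g f" for f g
    using nrm_minus[OF diff_mem, of f g] by (simp add: fun_dist_def)
  show "fun_dist X nrm f g = 0 \<longleftrightarrow> f = g" if "f \<in> X" "g \<in> X" for f g
    using that nrm_eq_0[OF diff_mem, of f g] by (simp add: fun_dist_def fun_eq_iff)
  show "fun_dist X nrm f h \<le> fun_dist X nrm f g + fun_dist X nrm g h"
    if "f \<in> X" "g \<in> X" "h \<in> X" for f g h
    using that nrm_triangle[OF diff_mem diff_mem, of f g g h] by (simp add: fun_dist_def)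
qed

locale disc_banach_space = disc_normed_space +
  assumes complete: "mcomplete"

text \<open>The norm of the unit is not required to be 1; the usual
  normalisation is a special case.\<close>

locale disc_banach_algebra = disc_banach_space A nrm
  for A :: "(complex \<Rightarrow> complex) set" and nrm :: "(complex \<Rightarrow> complex) \<Rightarrow> real" +
  assumes one_mem: "on_disc (\<lambda>z. 1) \<in> A"
    and mult_mem: "\<And>f g. f \<in> A \<Longrightarrow> g \<in> A \<Longrightarrow> (\<lambda>z. f z * g z) \<in> A"
    and nrm_mult: "\<And>f g. f \<in> A \<Longrightarrow> g \<in> A \<Longrightarrow> nrm (\<lambda>z. f z * g z) \<le> nrm f * nrm g"

definition multipliers :: "(complex \<Rightarrow> complex) set \<Rightarrow> (complex \<Rightarrow> complex) set" where
  "multipliers X = {\<phi> \<in> X. \<forall>f\<in>X. (\<lambda>z. \<phi> z * f z) \<in> X}"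

definition disc_polys :: "(complex \<Rightarrow> complex) set" where
  "disc_polys = range (\<lambda>p. on_disc (poly p))"

definition shift_invariant_span :: "(complex \<Rightarrow> complex) set \<Rightarrow> ((complex \<Rightarrow> complex) \<Rightarrow> real) \<Rightarrow>
    (complex \<Rightarrow> complex) \<Rightarrow> (complex \<Rightarrow> complex) set" where
  "shift_invariant_span X nrm f = fun_topology X nrm closure_of {(\<lambda>z. p z * f z) | p. p \<in> disc_polys}"

end

theory Submission
  imports Defs "HOL-Library.Function_Algebras"
begin

text \<open>Suppose \<open>\<bar>g\<bar> \<le> \<bar>f\<bar>\<close>. Applied to \<open>1 - l g\<close> and \<open>f\<close>, the corona hypothesis inverts
  \<open>1 - l g\<close> modulo the ideal \<open>f A\<close>, for every complex \<open>l\<close> and with polynomial growth of degree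
  \<open>a\<close> in \<open>l\<close>. In the quotient by the closure of \<open>f A\<close> the resolvent of \<open>g\<close> is thus an entire function of
  polynomial growth, hence a polynomial, so \<open>g ^ N\<close> lies in the closure of \<open>f A\<close> as soon as
  \<open>N > a\<close>. By the closed graph theorem multiplication operators are bounded, which transfers
  this to \<open>X\<close>. Vector-valued Liouville is replaced by finite averages over roots of unity, in the
  manner of Rickart's proof of the spectral radius formula, so that only the quotient seminorm
  is needed and neither the quotient algebra nor the Hahn-Banach theorem.\<close>

section \<open>Resolvents of polynomial growth\<close>

text \<open>A geometric sum whose ratio is an \<open>m\<close>-th root of unity; the ratio is not 1
  because \<open>0 < |k - n| < m\<close>.\<close>

lemma sum_cis_powers_eq_0:
  fixes k n m :: nat
  assumes "k < m" "n < m" "k \<noteq> n"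
  shows "(\<Sum>j<m. cis (2 * pi * (real k - real n) / real m) ^ j) = 0"
proof -
  let ?z = "cis (2 * pi * (real k - real n) / real m)"
  have m: "m > 0" using assms by simp
  have "?z \<noteq> 1"
  proof
    assume "?z = 1"
    then have "cos (2 * pi * (real k - real n) / real m) = 1"
      by (metis cis.sel(1) one_complex.sel(1))
    then obtain i :: int where "2 * pi * (real k - real n) / real m = of_int i * 2 * pi"
      using cos_one_2pi_int by blast
    then have "2 * pi * (real k - real n) = 2 * pi * (of_int i * real m)"
      using m by (simp add: field_simps)
    then have "real k - real n = of_int i * real m" by simp
    then have "real_of_int (int k - int n) = real_of_int (i * int m)" by simp
    then have eq: "int k - int n = i * int m" using of_int_eq_iff by blast
    have "\<bar>i * int m\<bar> < int m" using assms eq by linarith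
    then have "\<bar>i\<bar> * int m < 1 * int m" by (simp add: abs_mult)
    then have "\<bar>i\<bar> < 1" by (simp only: mult_less_cancel_right)
    then show False using eq assms by simp
  qed
  moreover have "?z ^ m = 1"
  proof -
    have "?z ^ m = cis (real m * (2 * pi * (real k - real n) / real m))"
      by (simp only: Complex.DeMoivre)
    also have "real m * (2 * pi * (real k - real n) / real m) = 2 * pi * (real k - real n)"
      using m by simp
    also have "cis \<dots> = 1" by (intro cis_multiple_2pi) simp
    finally show ?thesis .
  qed
  ultimately show ?thesis
    by (simp add: geometric_sum)
qed

text \<open>Abstract stand-in for a quotient algebra: elements count as equal when \<open>p\<close>
  of their difference is 0, so no quotient is formed. They lie in a subset \<open>S\<close> of a
  ring, so that ring arithmetic applies, and \<open>c\<close> embeds the scalars.\<close>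

locale seminormed_subalgebra =
  fixes S :: "'r::comm_ring_1 set" and c :: "complex \<Rightarrow> 'r" and p :: "'r \<Rightarrow> real"
  assumes c_1: "c 1 = 1"
    and c_add: "\<And>a b. c (a + b) = c a + c b"
    and c_mult: "\<And>a b. c (a * b) = c a * c b"
    and c_mem: "\<And>a. c a \<in> S"
    and add_mem: "\<And>x y. x \<in> S \<Longrightarrow> y \<in> S \<Longrightarrow> x + y \<in> S"
    and mult_mem: "\<And>x y. x \<in> S \<Longrightarrow> y \<in> S \<Longrightarrow> x * y \<in> S"
    and p_nonneg: "\<And>x. x \<in> S \<Longrightarrow> 0 \<le> p x"
    and p_add: "\<And>x y. x \<in> S \<Longrightarrow> y \<in> S \<Longrightarrow> p (x + y) \<le> p x + p y"
    and p_mult: "\<And>x y. x \<in> S \<Longrightarrow> y \<in> S \<Longrightarrow> p (x * y) \<le> p x * p y"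
    and p_scale: "\<And>a x. x \<in> S \<Longrightarrow> p (c a * x) \<le> cmod a * p x"
begin

section \<open>Arithmetic of the scalars and of the seminorm\<close>

lemma c_0: "c 0 = 0"
  using c_add[of 0 0] by simp

lemma c_minus: "c (- a) = - c a"
  using c_add[of a "- a"] c_0 by (simp add: add_eq_0_iff)

lemma c_diff: "c (a - b) = c a - c b"
  using c_add[of a "- b"] c_minus by simp

lemma c_sum: "c (sum f I) = (\<Sum>i\<in>I. c (f i))"
  by (induction I rule: infinite_finite_induct) (auto simp: c_0 c_add)

lemma c_power: "c (a ^ n) = c a ^ n"
  by (induction n) (auto simp: c_1 c_mult)

lemma one_mem: "1 \<in> S"
  using c_mem[of 1] c_1 by simp

lemma minus_mem: "x \<in> S \<Longrightarrow> - x \<in> S"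
  using mult_mem[OF c_mem[of "- 1"], of x] by (simp add: c_minus c_1)

lemma diff_mem: "x \<in> S \<Longrightarrow> y \<in> S \<Longrightarrow> x - y \<in> S"
  using add_mem[OF _ minus_mem, of x y] by simp

lemma power_mem: "x \<in> S \<Longrightarrow> x ^ n \<in> S"
  by (induction n) (auto simp: one_mem mult_mem)

lemma sum_mem: "(\<And>i. i \<in> I \<Longrightarrow> f i \<in> S) \<Longrightarrow> sum f I \<in> S"
proof (induction I rule: infinite_finite_induct)
  case (insert i I)
  then show ?case by (simp add: add_mem)
qed (use c_mem[of 0] c_0 in auto)

lemmas mem_intros = c_mem one_mem add_mem mult_mem diff_mem power_mem sum_mem

lemma p_0: "p 0 = 0"
  using p_scale[OF one_mem, of 0] p_nonneg[of 0] c_mem[of 0] by (simp add: c_0)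

lemma p_minus_le: "x \<in> S \<Longrightarrow> p (- x) \<le> p x"
  using p_scale[of x "- 1"] by (simp add: c_minus c_1)

lemma p_diff: "x \<in> S \<Longrightarrow> y \<in> S \<Longrightarrow> p (x - y) \<le> p x + p y"
  using p_add[OF _ minus_mem, of x y] p_minus_le[of y] by simp

lemma p_sum: "(\<And>i. i \<in> I \<Longrightarrow> f i \<in> S) \<Longrightarrow> p (sum f I) \<le> (\<Sum>i\<in>I. p (f i))"
proof (induction I rule: infinite_finite_induct)
  case (insert i I)
  have "p (f i + sum f I) \<le> p (f i) + p (sum f I)"
    using insert by (intro p_add sum_mem) auto
  with insert show ?case by simp
qed (auto simp: p_0)

lemma p_mult_eq_0: "x \<in> S \<Longrightarrow> y \<in> S \<Longrightarrow> p y = 0 \<Longrightarrow> p (x * y) = 0"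
  using p_mult[of x y] p_nonneg[OF mult_mem, of x y] by simp

lemma p_ge_of_p_diff_eq_0:
  assumes "x \<in> S" "y \<in> S" "p (x - y) = 0" shows "p y \<le> p x"
  using p_diff[OF assms(1) diff_mem[OF assms(1,2)]] assms(3) by simp

text \<open>Division-free form of the partial fraction expansion of \<open>x ^ n / (1 - x ^ m)\<close>
  over the roots of unity.\<close>

lemma roots_of_unity_average:
  assumes x: "x \<in> S" and n: "n < m"
    and u: "\<And>j. j < m \<Longrightarrow> u j \<in> S"
    and inv: "\<And>j. j < m \<Longrightarrow> p (1 - (1 - c (cis (2 * pi * real j / real m)) * x) * u j) = 0"
  shows "p ((1 - x ^ m) * (\<Sum>j<m. c (cis (2 * pi * real j / real m) ^ (m - n) / of_nat m) * u j)
             - x ^ n) = 0"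
proof -
  define w where "w j = cis (2 * pi * real j / real m)" for j
  have m: "m > 0" using n by simp
  have wm: "w j ^ m = 1" for j
  proof -
    have "w j ^ m = cis (real m * (2 * pi * real j / real m))" by (simp only: w_def Complex.DeMoivre)
    also have "real m * (2 * pi * real j / real m) = 2 * pi * real j" using m by simp
    finally show ?thesis using cis_multiple_2pi[of "real j"] by simp
  qed
  define y where "y j = c (w j) * x" for j
  define G where "G j = (\<Sum>k<m. y j ^ k)" for j
  define e where "e j = 1 - (1 - y j) * u j" for j
  \<comment> \<open>Since \<open>w j ^ m = 1\<close>, the exponent \<open>m - n\<close> stands for
    \<open>-n\<close>.\<close>
  define b where "b j = c (w j ^ (m - n) / of_nat m)" for j
  have ym: "y j ^ m = x ^ m" for j
    by (simp add: y_def power_mult_distrib wm c_1 flip: c_power)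
  have G: "1 - x ^ m = (1 - y j) * G j" for j
    unfolding G_def ym[of j, symmetric] by (rule one_diff_power_eq)
  \<comment> \<open>Discrete orthogonality keeps only the term \<open>k = n\<close> of the geometric
    sums \<open>G j\<close>.\<close>
  have avg: "(\<Sum>j<m. b j * G j) = x ^ n"
  proof -
    have "b j * y j ^ k = c (w j ^ (m - n) * w j ^ k / of_nat m) * x ^ k" for j k
    proof -
      have "w j ^ (m - n) * w j ^ k / of_nat m = w j ^ (m - n) / of_nat m * w j ^ k" by simp
      then show ?thesis
        by (simp only: b_def y_def power_mult_distrib c_mult c_power mult.assoc)
    qed
    then have "(\<Sum>j<m. b j * G j)
        = (\<Sum>j<m. \<Sum>k<m. c (w j ^ (m - n) * w j ^ k / of_nat m) * x ^ k)"
      by (simp only: G_def sum_distrib_left)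
    also have "\<dots> = (\<Sum>k<m. c (\<Sum>j<m. w j ^ (m - n) * w j ^ k / of_nat m) * x ^ k)"
      by (subst sum.swap) (simp add: c_sum sum_distrib_right)
    also have "\<dots> = (\<Sum>k<m. if k = n then x ^ n else 0)"
    proof (intro sum.cong refl)
      fix k assume k: "k \<in> {..<m}"
      have "w j ^ (m - n) * w j ^ k = cis (2 * pi * (real k - real n) / real m) ^ j" for j
      proof -
        have "w j ^ (m - n) * w j ^ k
            = cis (real (m - n) * (2 * pi * real j / real m) + real k * (2 * pi * real j / real m))"
          by (simp only: w_def Complex.DeMoivre cis_mult)
        also have "real (m - n) * (2 * pi * real j / real m) + real k * (2 * pi * real j / real m)
            = real j * (2 * pi * (real k - real n) / real m) + 2 * pi * real j"
          using n by (simp add: of_nat_diff field_simps)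
        also have "cis \<dots> = cis (2 * pi * (real k - real n) / real m) ^ j * cis (2 * pi * real j)"
          by (simp only: Complex.DeMoivre cis_mult)
        also have "cis (2 * pi * real j) = 1" by (intro cis_multiple_2pi) simp
        finally have "w j ^ (m - n) * w j ^ k = cis (2 * pi * (real k - real n) / real m) ^ j * 1" .
        then show ?thesis by (simp only: mult_1_right)
      qed
      then have "(\<Sum>j<m. w j ^ (m - n) * w j ^ k / of_nat m)
          = (\<Sum>j<m. cis (2 * pi * (real k - real n) / real m) ^ j) / of_nat m"
        by (simp add: sum_divide_distrib)
      also have "\<dots> = (if k = n then 1 else 0)"
        using sum_cis_powers_eq_0[of k m n] k n m by auto
      finally show "c (\<Sum>j<m. w j ^ (m - n) * w j ^ k / of_nat m) * x ^ k
          = (if k = n then x ^ n else 0)" by (simp add: c_0 c_1)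
    qed
    also have "\<dots> = x ^ n" using n by simp
    finally show ?thesis .
  qed
  have S: "b j * G j \<in> S" "y j \<in> S" for j
    unfolding b_def G_def y_def using x by (auto intro!: mem_intros)
  have eS: "e j \<in> S" if "j < m" for j
    unfolding e_def using that u S by (auto intro!: mem_intros)
  \<comment> \<open>Cancelling \<open>1 - y j\<close> against \<open>u j\<close> leaves the sum in
    \<open>avg\<close> and multiples of the errors \<open>e j\<close>, which have seminorm
    0.\<close>
  have "(1 - x ^ m) * (\<Sum>j<m. b j * u j) = (\<Sum>j<m. b j * G j * ((1 - y j) * u j))"
    unfolding sum_distrib_left
  proof (intro sum.cong refl)
    show "(1 - x ^ m) * (b j * u j) = b j * G j * ((1 - y j) * u j)" for j
      unfolding G[of j] by (simp add: mult_ac)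
  qed
  also have "\<dots> = (\<Sum>j<m. b j * G j - b j * G j * e j)"
    by (intro sum.cong refl) (simp add: e_def algebra_simps)
  also have "\<dots> = x ^ n - (\<Sum>j<m. b j * G j * e j)"
    by (simp add: sum_subtractf avg)
  finally have eq: "(1 - x ^ m) * (\<Sum>j<m. b j * u j) - x ^ n = - (\<Sum>j<m. b j * G j * e j)"
    by simp
  have "p (\<Sum>j<m. b j * G j * e j) \<le> (\<Sum>j<m. p (b j * G j * e j))"
    using mult_mem[OF S(1) eS] by (intro p_sum) auto
  also have "\<dots> = 0"
    using p_mult_eq_0[OF S(1) eS] inv by (intro sum.neutral) (auto simp: e_def y_def w_def)
  finally have "p (\<Sum>j<m. b j * G j * e j) \<le> 0" .
  moreover have sumS: "(\<Sum>j<m. b j * G j * e j) \<in> S"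
    using mult_mem[OF S(1) eS] by (intro sum_mem) auto
  ultimately have "p (- (\<Sum>j<m. b j * G j * e j)) = 0"
    using p_minus_le[OF sumS] p_nonneg[OF minus_mem[OF sumS]] by linarith
  then have "p ((1 - x ^ m) * (\<Sum>j<m. b j * u j) - x ^ n) = 0" by (simp only: eq)
  then show ?thesis by (simp add: b_def w_def)
qed

text \<open>The resolvent identity \<open>u - v = (a - b) g u v\<close> holds up to multiples of the
  two inversion errors, which have seminorm 0.\<close>

lemma resolvent_identity:
  assumes g: "g \<in> S" and u: "u \<in> S" "v \<in> S"
    and "p (1 - (1 - c a * g) * u) = 0" "p (1 - (1 - c b * g) * v) = 0"
    and M: "p u \<le> M" "p v \<le> M"
  shows "p (u - v) \<le> cmod (a - b) * (p g * M\<^sup>2)"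
proof -
  let ?e = "1 - (1 - c a * g) * u" and ?d = "1 - (1 - c b * g) * v"
  have S: "?e \<in> S" "?d \<in> S" using g u by (auto intro!: mem_intros)
  have eq: "u - v = (u * ?d - v * ?e) + c (a - b) * (g * (u * v))"
    by (simp add: c_diff algebra_simps)
  have "p (u * ?d - v * ?e) \<le> 0"
    using p_diff[of "u * ?d" "v * ?e"] p_mult_eq_0 u S assms(4,5) by (simp add: mult_mem)
  moreover have "p (c (a - b) * (g * (u * v))) \<le> cmod (a - b) * p (g * (u * v))"
    using g u by (intro p_scale mult_mem)
  moreover have "p (g * (u * v)) \<le> p g * M\<^sup>2"
  proof -
    have "p (g * (u * v)) \<le> p g * p (u * v)" using g u by (intro p_mult mult_mem)
    also have "p (u * v) \<le> p u * p v" using u by (intro p_mult)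
    also have "p u * p v \<le> M * M" using M p_nonneg u by (intro mult_mono) (auto intro: order.trans)
    finally show ?thesis
      using p_nonneg[OF g] by (simp add: mult_left_mono power2_eq_square)
  qed
  moreover have "p (u - v) \<le> p (u * ?d - v * ?e) + p (c (a - b) * (g * (u * v)))"
    unfolding eq using S g u by (intro p_add mem_intros) auto
  moreover have "cmod (a - b) * p (g * (u * v)) \<le> cmod (a - b) * (p g * M\<^sup>2)"
    using calculation(3) by (intro mult_left_mono) auto
  ultimately show ?thesis by linarith
qed

section \<open>Discrete Cauchy integrals over circles\<close>

context
  fixes g :: 'r and u :: "complex \<Rightarrow> 'r" and T M :: real
  assumes g: "g \<in> S" and u: "\<And>a. u a \<in> S"
    and inv: "\<And>a. p (1 - (1 - c a * g) * u a) = 0"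
    and M: "\<And>a. cmod a \<le> T \<Longrightarrow> p (u a) \<le> M"
begin

text \<open>An \<open>m\<close>-point discretisation of the Cauchy integral for the term
  \<open>r ^ n * g ^ n\<close> in the expansion of the resolvent. For exact inverses
  \<open>u\<close> its value is \<open>(r g) ^ n / (1 - (r g) ^ m)\<close>; the denominator accounts
  for aliasing.\<close>

definition circle_average :: "nat \<Rightarrow> nat \<Rightarrow> real \<Rightarrow> 'r" where
  "circle_average m n r = (\<Sum>j<m. c (cis (2 * pi * real j / real m) ^ (m - n) / of_nat m)
     * u (of_real r * cis (2 * pi * real j / real m)))"

lemma circle_average_mem: "circle_average m n r \<in> S"
  unfolding circle_average_def using u by (auto intro!: mem_intros)

lemma circle_average_inverse:
  assumes "n < m"
  shows "p ((1 - (c (of_real r) * g) ^ m) * circle_average m n r - (c (of_real r) * g) ^ n) = 0"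
  unfolding circle_average_def
proof (rule roots_of_unity_average)
  show "p (1 - (1 - c (cis (2 * pi * real j / real m)) * (c (of_real r) * g))
      * u (of_real r * cis (2 * pi * real j / real m))) = 0" for j
    using inv[of "of_real r * cis (2 * pi * real j / real m)"] by (simp add: c_mult mult_ac)
qed (use assms u g in \<open>auto intro!: mem_intros\<close>)

text \<open>There are \<open>m\<close> weights, each of modulus \<open>1 / m\<close>, so averaging
  preserves a uniform bound on the nodes.\<close>

lemma p_average_le:
  assumes "m > 0" "\<And>j. j < m \<Longrightarrow> v j \<in> S" "\<And>j. j < m \<Longrightarrow> p (v j) \<le> K"
  shows "p (\<Sum>j<m. c (cis (2 * pi * real j / real m) ^ (m - n) / of_nat m) * v j) \<le> K"
proof -
  have "p (\<Sum>j<m. c (cis (2 * pi * real j / real m) ^ (m - n) / of_nat m) * v j)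
      \<le> (\<Sum>j<m. p (c (cis (2 * pi * real j / real m) ^ (m - n) / of_nat m) * v j))"
    using assms by (intro p_sum mem_intros) auto
  also have "\<dots> \<le> (\<Sum>j<m. K / m)"
  proof (intro sum_mono)
    fix j assume j: "j \<in> {..<m}"
    have "p (c (cis (2 * pi * real j / real m) ^ (m - n) / of_nat m) * v j)
        \<le> cmod (cis (2 * pi * real j / real m) ^ (m - n) / of_nat m) * p (v j)"
      using assms j by (intro p_scale) auto
    also have "\<dots> = p (v j) / m" by (simp add: norm_divide norm_power)
    also have "\<dots> \<le> K / m" using assms j by (intro divide_right_mono) auto
    finally show "p (c (cis (2 * pi * real j / real m) ^ (m - n) / of_nat m) * v j) \<le> K / m" .
  qed
  also have "\<dots> = K" using assms by simp
  finally show ?thesis .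
qed

lemma p_circle_average_le:
  assumes "m > 0" "0 \<le> r" "r \<le> T"
  shows "p (circle_average m n r) \<le> M"
  unfolding circle_average_def using assms
  by (intro p_average_le u M) (auto simp: norm_mult)

text \<open>Nodes on the same ray are at distance \<open>s - r\<close>; the resolvent identity
  applies to each such pair.\<close>

lemma p_circle_average_diff_le:
  assumes "m > 0" "0 \<le> r" "r \<le> s" "s \<le> T"
  shows "p (circle_average m n s - circle_average m n r) \<le> (s - r) * (p g * M\<^sup>2)"
proof -
  have eq: "circle_average m n s - circle_average m n r
      = (\<Sum>j<m. c (cis (2 * pi * real j / real m) ^ (m - n) / of_nat m)
          * (u (of_real s * cis (2 * pi * real j / real m))
              - u (of_real r * cis (2 * pi * real j / real m))))"
    by (simp add: circle_average_def right_diff_distrib sum_subtractf)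
  have "p (u (of_real s * w) - u (of_real r * w)) \<le> (s - r) * (p g * M\<^sup>2)" if "cmod w = 1" for w
  proof -
    have "cmod (of_real s * w - of_real r * w) = s - r"
      using assms that by (simp add: norm_mult flip: left_diff_distrib of_real_diff)
    then show ?thesis
      using resolvent_identity[OF g u u inv inv M M, of "of_real s * w" "of_real r * w"] assms that
      by (simp add: norm_mult)
  qed
  then show ?thesis
    unfolding eq using assms u by (intro p_average_le diff_mem) auto
qed

text \<open>\<open>p_scale\<close> is only an inequality; applying it to \<open>a = r ^ m\<close>
  and to \<open>1 / a\<close> gives both directions.\<close>

lemma p_power_scale:
  assumes "0 \<le> r"
  shows "p ((c (of_real r) * g) ^ m) = r ^ m * p (g ^ m)"
\<comment> \<open>Outside this case \<open>r ^ m\<close> is positive: for \<open>m = 0\<close> it is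
  1 even if \<open>r = 0\<close>.\<close>
proof (cases "r = 0 \<and> m > 0")
  case True
  then show ?thesis by (simp add: c_0 p_0 power_0_left)
next
  case False
  define a where "a = r ^ m"
  have a: "a > 0" using False assms by (cases "m = 0") (auto simp: a_def)
  have eq: "(c (of_real r) * g) ^ m = c (of_real a) * g ^ m"
    by (simp add: power_mult_distrib c_power a_def)
  have ainv: "of_real (1 / a) * of_real a = (1 :: complex)"
    using a by simp
  have "g ^ m = c (of_real (1 / a)) * (c (of_real a) * g ^ m)"
    by (simp only: mult.assoc[symmetric] c_mult[symmetric] ainv c_1 mult_1)
  then have "p (g ^ m) \<le> cmod (of_real (1 / a)) * p (c (of_real a) * g ^ m)"
    using p_scale[of "c (of_real a) * g ^ m" "of_real (1 / a)"] g
    by (auto intro!: mem_intros)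
  moreover have "cmod (of_real (1 / a)) = 1 / a"
    using a by (simp only: norm_of_real abs_of_pos zero_less_divide_1_iff)
  ultimately have "p (g ^ m) \<le> 1 / a * p (c (of_real a) * g ^ m)"
    by (simp only:)
  then have "a * p (g ^ m) \<le> p (c (of_real a) * g ^ m)"
    using a by (simp add: field_simps)
  moreover have "p (c (of_real a) * g ^ m) \<le> cmod (of_real a) * p (g ^ m)"
    using g by (intro p_scale power_mem)
  moreover have "cmod (of_real a) = a" using a by (simp only: norm_of_real abs_of_pos)
  ultimately have "p (c (of_real a) * g ^ m) = a * p (g ^ m)" by (metis order.antisym)
  then show ?thesis by (simp only: eq a_def)
qed

text \<open>Rickart's elementary substitute for analytic continuation: the averages depend on the radius
  in a Lipschitz way that is uniform in the number of nodes, so that decay of the powers of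
  \<open>r g\<close> propagates to slightly larger radii.\<close>

lemma powers_decay_step:
  assumes r: "0 \<le> r" "r < t" "t < s" "s \<le> T" and small: "(s - r) * (p g * M\<^sup>2) \<le> 1 / 4"
    and decay: "(\<lambda>m. r ^ m * p (g ^ m)) \<longlonglongrightarrow> 0"
  shows "(\<lambda>m. t ^ m * p (g ^ m)) \<longlonglongrightarrow> 0"
proof -
  have "(\<lambda>m. r ^ m * p (g ^ m) * M) \<longlonglongrightarrow> 0"
    using tendsto_mult_right[OF decay, of M] by simp
  \<comment> \<open>The thresholds fit together: \<open>1 / 12 + 1 / 4 = 1 / 3\<close> will bound
    the distance of \<open>V s\<close> from 1.\<close>
  then have "eventually (\<lambda>m. r ^ m * p (g ^ m) * M < 1 / 12) sequentially"
    by (rule order_tendstoD) simp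
  then have "eventually (\<lambda>m. s ^ m * p (g ^ m) \<le> 1 / 2) sequentially"
    using eventually_gt_at_top[of 0]
  proof eventually_elim
    case (elim m)
    \<comment> \<open>For \<open>n = 0\<close> the average inverts \<open>1 - (a g) ^ m\<close>
      modulo the seminorm, so a small power forces an average near 1, and conversely.\<close>
    define V where "V a = circle_average m 0 a" for a
    define x where "x a = (c (of_real a) * g) ^ m" for a :: real
    have V: "V a \<in> S" and x: "x a \<in> S" for a
      using circle_average_mem g by (auto simp: V_def x_def intro!: mem_intros)
    have res: "p ((1 - x a) * V a - 1) = 0" for a
      using circle_average_inverse[of 0 m a] elim by (simp add: V_def x_def)
    have "p (V r - 1) = p ((1 - x r) * V r - 1 + x r * V r)"
      by (simp add: algebra_simps)
    also have "\<dots> \<le> p ((1 - x r) * V r - 1) + p (x r * V r)"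
      using V x by (intro p_add mem_intros)
    also have "\<dots> \<le> p (x r) * p (V r)" using res p_mult[OF x V] by simp
    also have "\<dots> \<le> r ^ m * p (g ^ m) * M"
      unfolding x_def p_power_scale[OF r(1)] V_def
      using elim r p_nonneg[OF power_mem[OF g]] by (intro mult_left_mono p_circle_average_le) auto
    finally have r1: "p (V r - 1) \<le> 1 / 12" using elim by simp
    have "p (V s - 1) = p ((V s - V r) + (V r - 1))" by simp
    also have "\<dots> \<le> p (V s - V r) + p (V r - 1)"
      using V by (intro p_add mem_intros)
    also have "p (V s - V r) \<le> (s - r) * (p g * M\<^sup>2)"
      unfolding V_def using elim r by (intro p_circle_average_diff_le) auto
    finally have s1: "p (V s - 1) \<le> 1 / 3" using r1 small by linarith
    have "p (x s * V s) = p ((V s - 1) - ((1 - x s) * V s - 1))"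
      by (simp add: algebra_simps)
    also have "\<dots> \<le> p (V s - 1)"
      using p_diff[of "V s - 1" "(1 - x s) * V s - 1"] res[of s] V x by (simp add: mem_intros)
    finally have s2: "p (x s * V s) \<le> 1 / 3" using s1 by simp
    \<comment> \<open>This leads to \<open>p (x s) \<le> 1 / 3 + p (x s) / 3\<close>, whence the
      bound 1/2.\<close>
    have "p (x s) = p (x s * V s - x s * (V s - 1))" by (simp add: algebra_simps)
    also have "\<dots> \<le> p (x s * V s) + p (x s * (V s - 1))"
      using V x by (intro p_diff mem_intros)
    also have "p (x s * (V s - 1)) \<le> p (x s) * p (V s - 1)"
      using V x by (intro p_mult mem_intros)
    also have "\<dots> \<le> p (x s) * (1 / 3)"
      using s1 p_nonneg x by (intro mult_left_mono) auto
    finally have "p (x s) \<le> 1 / 2" using s2 by linarith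
    then show ?case using p_power_scale[of s m] r by (simp add: x_def)
  qed
  \<comment> \<open>Boundedness at radius \<open>s\<close> yields geometric decay at the smaller
    radius \<open>t\<close>.\<close>
  then have "eventually (\<lambda>m. norm (t ^ m * p (g ^ m)) \<le> (t / s) ^ m * (1 / 2)) sequentially"
  proof eventually_elim
    case (elim m)
    have "t ^ m * p (g ^ m) = (t / s) ^ m * (s ^ m * p (g ^ m))"
      using r by (simp add: power_divide)
    also have "\<dots> \<le> (t / s) ^ m * (1 / 2)" using elim r by (intro mult_left_mono) auto
    finally show ?case using r p_nonneg[OF power_mem[OF g], of m] by simp
  qed
  moreover have "(\<lambda>m. (t / s) ^ m * (1 / 2)) \<longlonglongrightarrow> 0"
    using r by (intro tendsto_mult_left_zero LIMSEQ_power_zero) auto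
  ultimately show ?thesis by (rule Lim_null_comparison)
qed

text \<open>Finitely many equal steps lead from radius 0 to \<open>R\<close>. The factor 2 leaves
  room for the larger outer radius that each step uses.\<close>

lemma powers_decay:
  assumes "0 < R" "2 * R \<le> T"
  shows "(\<lambda>m. R ^ m * p (g ^ m)) \<longlonglongrightarrow> 0"
proof -
  define L where "L = p g * M\<^sup>2"
  have L: "0 \<le> L" using p_nonneg[OF g] by (simp add: L_def)
  \<comment> \<open>This makes \<open>2 * d * L \<le> 1 / 4\<close> for \<open>d = R / n\<close>, as
    needed when a step from \<open>k * d\<close> to \<open>(k + 1) * d\<close> uses the outer radius
    \<open>(k + 2) * d\<close>; the summand 1 keeps \<open>n\<close> positive.\<close>
  obtain n :: nat where n: "8 * R * L + 1 \<le> real n" using real_arch_simple by blast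
  have n0: "n > 0" using n mult_nonneg_nonneg[of R L] L assms by (cases "n = 0") (auto simp del: mult_nonneg_nonneg)
  define d where "d = R / n"
  have d: "d > 0" "n * d = R" using assms n0 by (auto simp: d_def)
  have "2 * d * L \<le> 1 / 4"
    using n n0 by (simp add: d_def field_simps)
  moreover have "(\<lambda>m. (k * d) ^ m * p (g ^ m)) \<longlonglongrightarrow> 0" if "k \<le> n" for k :: nat
    using that
  proof (induction k)
    case 0
    have "eventually (\<lambda>m. 0 = (real 0 * d) ^ m * p (g ^ m)) sequentially"
      using eventually_gt_at_top[of 0] by eventually_elim simp
    then show ?case by (rule Lim_transform_eventually[OF tendsto_const])
  next
    case (Suc k)
    show ?case
    proof (rule powers_decay_step)
      show "real k * d < real (Suc k) * d" "real (Suc k) * d < real (k + 2) * d"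
        using d by auto
      have "real (k + 2) \<le> 2 * real n" using Suc.prems n0 by linarith
      then have "real (k + 2) * d \<le> 2 * real n * d"
        using d by (intro mult_right_mono) auto
      then show "real (k + 2) * d \<le> T" using assms d by (simp only: mult.assoc)
      show "(real (k + 2) * d - real k * d) * (p g * M\<^sup>2) \<le> 1 / 4"
        using \<open>2 * d * L \<le> 1 / 4\<close> by (simp add: L_def algebra_simps)
    qed (use Suc d in auto)
  qed
  ultimately show ?thesis using d by fastforce
qed

text \<open>Fix \<open>n\<close> and let the number \<open>m\<close> of nodes grow: the averages
  stay bounded by \<open>M\<close>, and the aliasing error tends to 0 by
  \<open>powers_decay\<close>.\<close>

lemma Cauchy_estimate:
  assumes "0 < R" "2 * R \<le> T"
  shows "R ^ n * p (g ^ n) \<le> M"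
proof -
  have "R ^ n * p (g ^ n) \<le> M + R ^ m * p (g ^ m) * M" if m: "m > n" for m
  proof -
    let ?x = "c (of_real R) * g" and ?V = "circle_average m n R"
    have x: "?x ^ k \<in> S" for k using g by (intro mem_intros)
    note V = circle_average_mem[of m n R]
    have VM: "p ?V \<le> M" using assms m by (intro p_circle_average_le) auto
    have "R ^ n * p (g ^ n) = p (?x ^ n)" using assms p_power_scale by simp
    also have "\<dots> \<le> p ((1 - ?x ^ m) * ?V)"
      using circle_average_inverse[OF m] x V by (intro p_ge_of_p_diff_eq_0 mult_mem diff_mem one_mem x)
    also have "(1 - ?x ^ m) * ?V = ?V - ?x ^ m * ?V" by (simp add: algebra_simps)
    also have "p \<dots> \<le> p ?V + p (?x ^ m * ?V)" using x V by (intro p_diff mult_mem)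
    also have "p (?x ^ m * ?V) \<le> p (?x ^ m) * p ?V" using x V by (rule p_mult)
    also have "p (?x ^ m) * p ?V \<le> p (?x ^ m) * M"
      using VM p_nonneg[OF x] by (rule mult_left_mono)
    finally show ?thesis using VM assms p_power_scale[of R m] by simp
  qed
  then have "eventually (\<lambda>m. R ^ n * p (g ^ n) \<le> M + R ^ m * p (g ^ m) * M) sequentially"
    by (rule eventually_mono[OF eventually_gt_at_top[of n]])
  moreover have "(\<lambda>m. M + R ^ m * p (g ^ m) * M) \<longlonglongrightarrow> M + 0 * M"
    by (intro tendsto_intros powers_decay assms)
  ultimately show ?thesis
    by (intro tendsto_lowerbound[where F = sequentially]) auto
qed

end

text \<open>Liouville's argument: growth of degree \<open>b\<close> makes the Cauchy estimate of
  order \<open>n > b\<close> decay like \<open>1 / R\<close>.\<close>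

theorem nilpotent_of_polynomial_resolvent:
  assumes g: "g \<in> S" and u: "\<And>a. u a \<in> S"
    and inv: "\<And>a. p (1 - (1 - c a * g) * u a) = 0"
    and growth: "\<And>a. p (u a) \<le> B * (1 + cmod a) ^ b"
    and n: "b < n"
  shows "p (g ^ n) = 0"
proof -
  have B: "0 \<le> B" using growth[of 0] p_nonneg[OF u[of 0]] by simp
  have bound: "p (g ^ n) \<le> B * 3 ^ b / R" if R: "1 \<le> R" for R
  proof -
    \<comment> \<open>The resolvent is bounded on the disc of radius \<open>2 * R\<close>, the
      headroom that \<open>Cauchy_estimate\<close> requires.\<close>
    have "R ^ n * p (g ^ n) \<le> B * (1 + 2 * R) ^ b"
    proof (rule Cauchy_estimate[OF g u inv, of "2 * R"])
      fix a assume "cmod a \<le> 2 * R"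
      then have "B * (1 + cmod a) ^ b \<le> B * (1 + 2 * R) ^ b"
        using B by (intro mult_left_mono power_mono) auto
      then show "p (u a) \<le> B * (1 + 2 * R) ^ b" using growth[of a] by simp
    qed (use R in auto)
    also have "\<dots> \<le> B * (3 * R) ^ b"
      using R B by (intro mult_left_mono power_mono) auto
    finally have "R ^ n * p (g ^ n) \<le> B * (3 * R) ^ b" .
    moreover have "R ^ Suc b * p (g ^ n) \<le> R ^ n * p (g ^ n)"
      using n R p_nonneg[OF power_mem[OF g]] by (intro mult_right_mono power_increasing) auto
    ultimately have "R * R ^ b * p (g ^ n) \<le> B * 3 ^ b * R ^ b"
      by (simp add: power_mult_distrib mult_ac)
    then have "(R * p (g ^ n)) * R ^ b \<le> (B * 3 ^ b) * R ^ b" by (simp add: mult_ac)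
    then have "R * p (g ^ n) \<le> B * 3 ^ b"
      using R by (subst (asm) mult_le_cancel_right_pos) auto
    then show ?thesis using R by (simp add: field_simps)
  qed
  have "((\<lambda>R. B * 3 ^ b / R) \<longlongrightarrow> 0) at_top"
    by (intro tendsto_divide_0[OF tendsto_const] filterlim_at_top_imp_at_infinity filterlim_ident)
  moreover have "eventually (\<lambda>R. p (g ^ n) \<le> B * 3 ^ b / R) at_top"
    using eventually_ge_at_top[of 1] by eventually_elim (rule bound)
  ultimately have "p (g ^ n) \<le> 0"
    by (intro tendsto_lowerbound[where F = at_top]) auto
  then show ?thesis using p_nonneg[OF power_mem[OF g], of n] by simp
qed

end


section \<open>Boundedness of multiplication operators\<close>

context disc_normed_space
begin

text \<open>A continuous linear functional is bounded: scale \<open>f\<close> into a ball around 0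
  that evaluation maps into the unit disc.\<close>

lemma evaluation_bounded:
  assumes "continuous_map (fun_topology X nrm) euclidean (\<lambda>f. f w)"
  obtains e where "0 \<le> e" "\<And>f. f \<in> X \<Longrightarrow> cmod (f w) \<le> e * nrm f"
proof -
  have "openin mtopology {f \<in> topspace mtopology. f w \<in> ball 0 1}"
    using openin_continuous_map_preimage[OF assms, of "ball 0 1"] by (simp add: fun_topology_def)
  then obtain r where r: "r > 0" "mball (\<lambda>z. 0) r \<subseteq> {f \<in> X. f w \<in> ball 0 1}"
    using zero_mem unfolding openin_mtopology by auto
  have "cmod (f w) \<le> 2 / r * nrm f" if f: "f \<in> X" for f
  proof (cases "nrm f = 0")
    case True
    then have "f = (\<lambda>z. 0)" using f nrm_eq_0 by blast
    then show ?thesis using True by simp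
  next
    case False
    then have pos: "nrm f > 0" using nrm_nonneg[OF f] by simp
    define a where "a = r / (2 * nrm f)"
    have a: "a > 0" using pos r by (simp add: a_def)
    let ?h = "\<lambda>z. of_real a * f z"
    have h: "?h \<in> X" by (rule scale_mem[OF f])
    have "nrm ?h = r / 2"
      using nrm_scale[OF f, of "of_real a"] a pos r by (simp add: a_def norm_divide norm_mult)
    then have "fun_dist X nrm (\<lambda>z. 0) ?h < r"
      using h zero_mem nrm_minus[OF h] r by (simp add: fun_dist_def)
    then have "?h \<in> mball (\<lambda>z. 0) r"
      using h zero_mem by (simp add: in_mball)
    then have "a * cmod (f w) < 1"
      using r a by (auto simp: norm_mult)
    then show ?thesis using pos r by (simp add: a_def field_simps)
  qed
  then show thesis using r by (intro that[of "2 / r"]) auto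
qed

lemma mem_closure_iff:
  "f \<in> fun_topology X nrm closure_of S \<longleftrightarrow>
    f \<in> X \<and> (\<forall>\<epsilon>>0. \<exists>g\<in>S. g \<in> X \<and> nrm (\<lambda>z. f z - g z) < \<epsilon>)"
  unfolding fun_topology_def metric_closure_of by (auto simp: fun_dist_def)

lemma nrm_diff_commute: "f \<in> X \<Longrightarrow> g \<in> X \<Longrightarrow> nrm (\<lambda>z. f z - g z) = nrm (\<lambda>z. g z - f z)"
  using nrm_minus[OF diff_mem, of f g] by simp

lemma nrm_triangle_diff:
  assumes "f \<in> X" "g \<in> X" "h \<in> X"
  shows "nrm (\<lambda>z. f z - h z) \<le> nrm (\<lambda>z. f z - g z) + nrm (\<lambda>z. g z - h z)"
  using nrm_triangle[OF diff_mem diff_mem, of f g g h] assms by simp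

end

text \<open>The increments are dominated by a geometric series of sum \<open>2 * C\<close>, which
  also bounds the distance from \<open>s 0\<close> to the limit.\<close>

lemma (in disc_banach_space) geometric_Cauchy_limit:
  assumes s: "\<And>k. s k \<in> X"
    and step: "\<And>k. nrm (\<lambda>z. s (Suc k) z - s k z) \<le> C * (1 / 2) ^ k"
  obtains l where "l \<in> X" "nrm (\<lambda>z. l z - s 0 z) \<le> 2 * C"
    "(\<lambda>k. nrm (\<lambda>z. s k z - l z)) \<longlonglongrightarrow> 0"
proof -
  have C: "0 \<le> C"
    using order.trans[OF nrm_nonneg[OF diff_mem[OF s s]] step[of 0]] by simp
  \<comment> \<open>The bound is the exact partial sum of the geometric series, so that the
    induction closes.\<close>
  have tele: "nrm (\<lambda>z. s (k + d) z - s k z) \<le> 2 * C * ((1 / 2) ^ k - (1 / 2) ^ (k + d))" for k d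
  proof (induction d)
    case 0
    then show ?case using nrm_eq_0[OF zero_mem] by simp
  next
    case (Suc d)
    have "nrm (\<lambda>z. s (k + Suc d) z - s k z)
        \<le> nrm (\<lambda>z. s (Suc (k + d)) z - s (k + d) z) + nrm (\<lambda>z. s (k + d) z - s k z)"
      using nrm_triangle_diff[of "s (Suc (k + d))" "s (k + d)" "s k"] s by simp
    also have "\<dots> \<le> C * (1 / 2) ^ (k + d) + 2 * C * ((1 / 2) ^ k - (1 / 2) ^ (k + d))"
      using step Suc by (intro add_mono) auto
    also have "\<dots> = 2 * C * ((1 / 2) ^ k - (1 / 2) ^ (k + Suc d))" by (simp add: algebra_simps)
    finally show ?case .
  qed
  have near: "nrm (\<lambda>z. s m z - s k z) \<le> 2 * C * (1 / 2) ^ k" if "k \<le> m" for k m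
  proof -
    have "nrm (\<lambda>z. s m z - s k z) \<le> 2 * C * ((1 / 2) ^ k - (1 / 2) ^ m)"
      using tele[of k "m - k"] that by simp
    also have "\<dots> \<le> 2 * C * (1 / 2) ^ k" using C by (intro mult_left_mono) auto
    finally show ?thesis .
  qed
  have lim0: "(\<lambda>k. 2 * C * (1 / 2) ^ k) \<longlonglongrightarrow> 0"
    by (intro tendsto_mult_right_zero LIMSEQ_power_zero) simp
  have "MCauchy s"
    unfolding MCauchy_def
  proof (intro conjI allI impI)
    show "range s \<subseteq> X" using s by auto
    fix \<epsilon> :: real assume "\<epsilon> > 0"
    then obtain N where N: "2 * C * (1 / 2) ^ k < \<epsilon>" if "k \<ge> N" for k
      using order_tendstoD(2)[OF lim0, of \<epsilon>] by (auto simp: eventually_sequentially)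
    have "fun_dist X nrm (s k) (s m) < \<epsilon>" if "N \<le> k" "k \<le> m" for k m
      using near[OF that(2)] N[OF that(1)] nrm_diff_commute[OF s s, of k m] s
      by (simp add: fun_dist_def)
    then show "\<exists>N. \<forall>n n'. N \<le> n \<longrightarrow> N \<le> n' \<longrightarrow> fun_dist X nrm (s n) (s n') < \<epsilon>"
      by (metis commute nle_le)
  qed
  then obtain l where l: "limitin mtopology s l sequentially"
    using complete unfolding mcomplete_def by blast
  then have lX: "l \<in> X" by (rule limitin_mspace)
  have lim: "(\<lambda>k. nrm (\<lambda>z. s k z - l z)) \<longlonglongrightarrow> 0"
    using l s lX unfolding limitin_metric_dist_null by (simp add: fun_dist_def)
  have "nrm (\<lambda>z. l z - s 0 z) \<le> nrm (\<lambda>z. s k z - l z) + 2 * C" for k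
    using nrm_triangle_diff[of l "s k" "s 0"] lX s nrm_diff_commute[OF lX s, of k] near[of 0 k] by simp
  moreover have "(\<lambda>k. nrm (\<lambda>z. s k z - l z) + 2 * C) \<longlonglongrightarrow> 0 + 2 * C"
    by (intro tendsto_intros lim)
  ultimately have "nrm (\<lambda>z. l z - s 0 z) \<le> 2 * C"
    by (intro tendsto_lowerbound[where F = sequentially]) auto
  then show thesis using lX lim that by blast
qed

text \<open>Evaluation is bounded, so norm limits are pointwise limits; this lets limits in
  different spaces be compared.\<close>

lemma (in disc_normed_space) evaluation_limit:
  assumes "continuous_map (fun_topology X nrm) euclidean (\<lambda>f. f w)"
    and s: "\<And>k. s k \<in> X" "l \<in> X" and lim: "(\<lambda>k. nrm (\<lambda>z. s k z - l z)) \<longlonglongrightarrow> 0"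
  shows "(\<lambda>k. s k w) \<longlonglongrightarrow> l w"
proof -
  obtain e where e: "\<And>f. f \<in> X \<Longrightarrow> cmod (f w) \<le> e * nrm f"
    using evaluation_bounded[OF assms(1)] by blast
  have "(\<lambda>k. s k w - l w) \<longlonglongrightarrow> 0"
  proof (rule Lim_null_comparison)
    show "(\<lambda>k. e * nrm (\<lambda>z. s k z - l z)) \<longlonglongrightarrow> 0"
      using tendsto_mult_right_zero[OF lim] .
    show "eventually (\<lambda>k. norm (s k w - l w) \<le> e * nrm (\<lambda>z. s k z - l z)) sequentially"
      using e[OF diff_mem[OF s(1) s(2)]] by simp
  qed
  then show ?thesis by (simp add: LIM_zero_iff)
qed

text \<open>An instance of the closed graph theorem: continuity of the evaluations makes the graph of
  every multiplication operator closed.\<close>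

lemma multiplication_operator_bounded:
  assumes "disc_banach_space Y nY" "disc_banach_space Z nZ"
    and evY: "\<And>w. w \<in> unit_disc \<Longrightarrow> continuous_map (fun_topology Y nY) euclidean (\<lambda>f. f w)"
    and evZ: "\<And>w. w \<in> unit_disc \<Longrightarrow> continuous_map (fun_topology Z nZ) euclidean (\<lambda>f. f w)"
    and maps: "\<And>f. f \<in> Y \<Longrightarrow> (\<lambda>z. \<phi> z * f z) \<in> Z"
  obtains K where "K > 0" "\<And>f. f \<in> Y \<Longrightarrow> nZ (\<lambda>z. \<phi> z * f z) \<le> K * nY f"
proof -
  interpret Y: disc_banach_space Y nY by fact
  interpret Z: disc_banach_space Z nZ by fact
  define T where "T f = (\<lambda>z. \<phi> z * f z)" for f
  have T: "T f \<in> Z" if "f \<in> Y" for f using maps[OF that] by (simp add: T_def)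
  have T_diff: "T (\<lambda>z. f z - g z) = (\<lambda>z. T f z - T g z)" for f g
    by (simp add: T_def right_diff_distrib)
  have T_scale: "T (\<lambda>z. a * f z) = (\<lambda>z. a * T f z)" for a f
    by (simp add: T_def mult_ac)
  \<comment> \<open>These closed sets cover \<open>Y\<close>, so by Baire's theorem one of them
    contains a ball.\<close>
  define B where "B n = Y.mtopology closure_of {f \<in> Y. nZ (T f) \<le> real n}" for n :: nat
  have memB: "f \<in> B n \<longleftrightarrow> f \<in> Y \<and> (\<forall>\<epsilon>>0. \<exists>g. g \<in> Y \<and> nZ (T g) \<le> real n \<and> nY (\<lambda>z. f z - g z) < \<epsilon>)"
    for f n
    using Y.mem_closure_iff[of f] unfolding B_def fun_topology_def by auto
  have "\<exists>n. Y.mtopology interior_of B n \<noteq> {}"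
  proof (rule ccontr)
    assume "\<not> ?thesis"
    then have "Y.mtopology interior_of \<Union> (range B) = {}"
      by (intro Y.metric_Baire_category_alt Y.complete) (auto simp: B_def)
    moreover have "\<Union> (range B) = Y"
    proof (intro subset_antisym subsetI)
      fix f assume f: "f \<in> Y"
      obtain n :: nat where "nZ (T f) \<le> real n" using real_arch_simple by blast
      then have "f \<in> B n"
        using f Y.nrm_eq_0[OF Y.zero_mem] by (auto simp: memB intro!: exI[of _ f])
      then show "f \<in> \<Union> (range B)" by blast
    qed (auto simp: memB)
    ultimately show False
      using Y.zero_mem interior_of_topspace[of Y.mtopology] by simp
  qed
  then obtain n h r where h: "h \<in> Y" and r: "r > 0" "Y.mball h r \<subseteq> B n"
    unfolding Y.metric_interior_of by auto
  define L where "L = 2 * real n / r"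
  have L: "0 \<le> L" using r by (simp add: L_def)
  \<comment> \<open>Writing \<open>f = ((h + f) - (h - f)) / 2\<close> moves the ball from centre
    \<open>h\<close> to centre 0 and keeps the bound \<open>n\<close>.\<close>
  have half: "\<exists>f'\<in>Y. nZ (T f') \<le> real n \<and> nY (\<lambda>z. f z - f' z) < \<epsilon>"
    if f: "f \<in> Y" "nY f < r" and \<epsilon>: "\<epsilon> > 0" for f \<epsilon>
  proof -
    let ?p = "\<lambda>z. h z + f z" and ?m = "\<lambda>z. h z - f z"
    have pm: "?p \<in> Y" "?m \<in> Y" using h f by (auto intro: Y.add_mem Y.diff_mem)
    have "fun_dist Y nY h ?p < r" "fun_dist Y nY h ?m < r"
      using h f pm Y.nrm_minus[OF f(1)] by (simp_all add: fun_dist_def)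
    then have "?p \<in> B n" "?m \<in> B n" using r h pm by (auto simp: subset_iff)
    then obtain a b where a: "a \<in> Y" "nZ (T a) \<le> real n" "nY (\<lambda>z. ?p z - a z) < \<epsilon>"
      and b: "b \<in> Y" "nZ (T b) \<le> real n" "nY (\<lambda>z. ?m z - b z) < \<epsilon>"
      using \<epsilon> unfolding memB by blast
    define q where "q = (\<lambda>z. 1 / 2 * (a z - b z))"
    have q: "q \<in> Y" unfolding q_def using a b by (intro Y.scale_mem Y.diff_mem)
    have "T q = (\<lambda>z. 1 / 2 * (T a z - T b z))" by (simp only: q_def T_scale T_diff)
    then have "nZ (T q) = 1 / 2 * nZ (\<lambda>z. T a z - T b z)"
      using Z.nrm_scale[OF Z.diff_mem[OF T[OF a(1)] T[OF b(1)]], of "1 / 2"] by simp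
    moreover have "nZ (\<lambda>z. T a z - T b z) \<le> nZ (T a) + nZ (T b)"
      using Z.nrm_triangle[OF T[OF a(1)] Z.scale_mem[OF T[OF b(1)], of "-1"]]
        Z.nrm_minus[OF T[OF b(1)]] by simp
    ultimately have "nZ (T q) \<le> real n" using a b by simp
    moreover have "nY (\<lambda>z. f z - q z) < \<epsilon>"
    proof -
      have eq: "(\<lambda>z. f z - q z) = (\<lambda>z. 1 / 2 * ((?p z - a z) - (?m z - b z)))"
        by (auto simp: q_def field_simps)
      have d: "(\<lambda>z. ?p z - a z) \<in> Y" "(\<lambda>z. ?m z - b z) \<in> Y"
        using pm a b by (auto intro: Y.diff_mem)
      have "nY (\<lambda>z. f z - q z) = 1 / 2 * nY (\<lambda>z. (?p z - a z) - (?m z - b z))"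
        unfolding eq using Y.nrm_scale[OF Y.diff_mem[OF d], of "1 / 2"] by simp
      also have "nY (\<lambda>z. (?p z - a z) - (?m z - b z)) \<le> nY (\<lambda>z. ?p z - a z) + nY (\<lambda>z. ?m z - b z)"
        using Y.nrm_triangle[OF d(1) Y.scale_mem[OF d(2), of "-1"]] Y.nrm_minus[OF d(2)] by simp
      finally show ?thesis using a(3) b(3) by simp
    qed
    ultimately show ?thesis using q by blast
  qed
  \<comment> \<open>Scaling \<open>f\<close> to norm \<open>r / 2\<close> puts it inside the ball;
    scaling back produces the constant \<open>L = 2 * n / r\<close>.\<close>
  have approx: "\<exists>f'\<in>Y. nZ (T f') \<le> L * nY f \<and> nY (\<lambda>z. f z - f' z) < \<epsilon>"
    if f: "f \<in> Y" and \<epsilon>: "\<epsilon> > 0" for f \<epsilon>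
  proof (cases "nY f = 0")
    case True
    then have "f = (\<lambda>z. 0)" using Y.nrm_eq_0 f by blast
    then show ?thesis
      using \<epsilon> Y.zero_mem Y.nrm_eq_0[OF Y.zero_mem] Z.nrm_eq_0[OF Z.zero_mem]
      by (intro bexI[of _ "\<lambda>z. 0"]) (auto simp: T_def)
  next
    case False
    then have pos: "nY f > 0" using Y.nrm_nonneg[OF f] by simp
    define a where "a = r / (2 * nY f)"
    have a: "a > 0" using pos r by (simp add: a_def)
    have cm: "cmod (of_real x) = x" if "x > 0" for x using that by simp
    have "nY (\<lambda>z. of_real a * f z) = r / 2"
      using Y.nrm_scale[OF f, of "of_real a"] a pos cm[of a] by (simp only:) (simp add: a_def)
    then obtain f' where f': "f' \<in> Y" "nZ (T f') \<le> real n" "nY (\<lambda>z. of_real a * f z - f' z) < a * \<epsilon>"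
      using half[OF Y.scale_mem[OF f, of "of_real a"], of "a * \<epsilon>"] a r \<epsilon> by auto
    let ?k = "\<lambda>z. of_real (1 / a) * f' z"
    have "nZ (T ?k) = 1 / a * nZ (T f')"
      using Z.nrm_scale[OF T[OF f'(1)], of "of_real (1 / a)"] a cm[of "1 / a"] by (simp only: T_scale) simp
    also have "\<dots> \<le> 1 / a * n" using f' a by (intro mult_left_mono) auto
    also have "\<dots> = L * nY f" by (simp add: a_def L_def)
    finally have 1: "nZ (T ?k) \<le> L * nY f" .
    have eq: "(\<lambda>z. f z - ?k z) = (\<lambda>z. of_real (1 / a) * (of_real a * f z - f' z))"
      using a by (auto simp: field_simps)
    have "nY (\<lambda>z. f z - ?k z) = 1 / a * nY (\<lambda>z. of_real a * f z - f' z)"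
      unfolding eq
      using Y.nrm_scale[OF Y.diff_mem[OF Y.scale_mem[OF f] f'(1)], of "of_real (1 / a)" "of_real a"]
        a cm[of "1 / a"] by simp
    also have "\<dots> < \<epsilon>" using f' a by (simp add: field_simps)
    finally show ?thesis using 1 Y.scale_mem[OF f'(1)] by blast
  qed
  have bound: "nZ (T f) \<le> 2 * L * nY f" if f: "f \<in> Y" for f
  proof (cases "nY f = 0")
    case True
    then have "f = (\<lambda>z. 0)" using Y.nrm_eq_0 f by blast
    then show ?thesis
      using Y.nrm_eq_0[OF Y.zero_mem] Z.nrm_eq_0[OF Z.zero_mem] by (auto simp: T_def)
  next
    case False
    then have pos: "nY f > 0" using Y.nrm_nonneg[OF f] by simp
    \<comment> \<open>Approximate \<open>f\<close>, then the remainder, and so on: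
      \<open>F k\<close> is the remainder after \<open>k\<close> corrections and \<open>s k\<close>
      is their sum. The tolerances halve, so the images of the corrections are geometrically
      summable.\<close>
    define P where "P e k = (SOME k'. k' \<in> Y \<and> nZ (T k') \<le> L * nY k \<and> nY (\<lambda>z. k z - k' z) < e)"
      for e :: real and k
    have P: "P e k \<in> Y" "nZ (T (P e k)) \<le> L * nY k" "nY (\<lambda>z. k z - P e k z) < e"
      if "k \<in> Y" "e > 0" for e k
      using someI_ex[of "\<lambda>k'. k' \<in> Y \<and> nZ (T k') \<le> L * nY k \<and> nY (\<lambda>z. k z - k' z) < e"]
        approx[OF that] unfolding P_def by blast+
    define e where "e k = nY f * (1 / 2) ^ k" for k :: nat
    have e: "e k > 0" for k using pos by (simp add: e_def)
    define F where "F = rec_nat f (\<lambda>k G. (\<lambda>z. G z - P (e (Suc k)) G z))"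
    have F0: "F 0 = f" and FS: "F (Suc k) = (\<lambda>z. F k z - P (e (Suc k)) (F k) z)" for k
      by (simp_all add: F_def)
    have FY: "F k \<in> Y" for k
      by (induction k) (auto simp: F0 FS f intro!: Y.diff_mem P(1) e)
    have Fe: "nY (F k) \<le> e k" for k
    proof (cases k)
      case (Suc j)
      then show ?thesis using P(3)[OF FY e, of j "Suc j"] by (simp add: FS)
    qed (simp add: F0 e_def)
    define s where "s k = (\<lambda>z. f z - F k z)" for k
    have sY: "s k \<in> Y" for k unfolding s_def by (intro Y.diff_mem f FY)
    have step: "nZ (\<lambda>z. T (s (Suc k)) z - T (s k) z) \<le> L * nY f * (1 / 2) ^ k" for k
    proof -
      have "(\<lambda>z. s (Suc k) z - s k z) = P (e (Suc k)) (F k)"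
        by (auto simp: s_def FS)
      then have "(\<lambda>z. T (s (Suc k)) z - T (s k) z) = T (P (e (Suc k)) (F k))"
        by (simp flip: T_diff)
      then have "nZ (\<lambda>z. T (s (Suc k)) z - T (s k) z) \<le> L * nY (F k)"
        using P(2)[OF FY e] by simp
      also have "\<dots> \<le> L * e k" using L Fe by (intro mult_left_mono)
      finally show ?thesis by (simp add: e_def)
    qed
    obtain l where l: "l \<in> Z" "nZ (\<lambda>z. l z - T (s 0) z) \<le> 2 * (L * nY f)"
      and lim: "(\<lambda>k. nZ (\<lambda>z. T (s k) z - l z)) \<longlonglongrightarrow> 0"
      using Z.geometric_Cauchy_limit[of "\<lambda>k. T (s k)", OF T[OF sY] step] by blast
    have "(\<lambda>k. nY (\<lambda>z. s k z - f z)) \<longlonglongrightarrow> 0"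
    proof (rule Lim_null_comparison)
      show "eventually (\<lambda>k. norm (nY (\<lambda>z. s k z - f z)) \<le> e k) sequentially"
        using Fe Y.nrm_nonneg[OF FY] Y.nrm_minus[OF FY] by (simp add: s_def)
      show "e \<longlonglongrightarrow> 0" unfolding e_def
        by (intro tendsto_mult_right_zero LIMSEQ_power_zero) simp
    qed
    \<comment> \<open>Pointwise on the disc, \<open>T (s k)\<close> tends to \<open>T f\<close> by
      convergence in \<open>Y\<close> and to \<open>l\<close> by convergence in
      \<open>Z\<close>.\<close>
    then have "(\<lambda>k. T (s k) w) \<longlonglongrightarrow> T f w" if "w \<in> unit_disc" for w
      unfolding T_def using that by (intro tendsto_intros Y.evaluation_limit evY sY f)
    moreover have "(\<lambda>k. T (s k) w) \<longlonglongrightarrow> l w" if "w \<in> unit_disc" for w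
      using that by (intro Z.evaluation_limit[OF evZ] T sY l lim)
    ultimately have "T f w = l w" for w
      using LIMSEQ_unique[of "\<lambda>k. T (s k) w" "T f w" "l w"]
        Z.zero_outside[OF T[OF f], of w] Z.zero_outside[OF l(1), of w]
      by (cases "w \<in> unit_disc") auto
    then have "T f = l" by blast
    then show ?thesis using l(2) by (simp add: s_def F0 T_def)
  qed
  show thesis
  proof (rule that)
    \<comment> \<open>\<open>L\<close> is 0 when \<open>n = 0\<close>; adding 1 makes the constant
      positive.\<close>
    show "2 * L + 1 > 0" using L by simp
    show "nZ (\<lambda>z. \<phi> z * f z) \<le> (2 * L + 1) * nY f" if "f \<in> Y" for f
      using bound[OF that] Y.nrm_nonneg[OF that] by (simp add: T_def algebra_simps)
  qed
qed


section \<open>Division by \<open>f\<close> in the algebra\<close>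

lemma power_fun_apply: "(f ^ n) x = f x ^ n" for f :: "'a \<Rightarrow> 'b::comm_semiring_1"
  by (induction n) auto

context disc_banach_algebra
begin

lemma const_mem: "on_disc (\<lambda>_. a) \<in> A"
proof -
  have "on_disc (\<lambda>_. a) = (\<lambda>z. a * on_disc (\<lambda>_. 1) z)" by (auto simp: on_disc_def)
  then show ?thesis using scale_mem[OF one_mem] by simp
qed

lemma on_disc_id: "f \<in> A \<Longrightarrow> on_disc f = f"
  using zero_outside by (auto simp: on_disc_def)

text \<open>Exponents are positive because the zeroth power equals 1 off the disc as well, where
  elements of \<open>A\<close> vanish.\<close>

lemma power_mem: "f \<in> A \<Longrightarrow> (\<lambda>z. f z ^ Suc n) \<in> A"
  by (induction n) (auto intro: mult_mem)

lemma nrm_power: "f \<in> A \<Longrightarrow> nrm (\<lambda>z. f z ^ Suc n) \<le> nrm f ^ Suc n"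
proof (induction n)
  case (Suc n)
  have "nrm (\<lambda>z. f z ^ Suc (Suc n)) \<le> nrm f * nrm (\<lambda>z. f z ^ Suc n)"
    using nrm_mult[OF Suc.prems power_mem[OF Suc.prems, of n]] by simp
  also have "\<dots> \<le> nrm f * nrm f ^ Suc n"
    using Suc by (intro mult_left_mono nrm_nonneg) auto
  finally show ?case by simp
qed simp

text \<open>Evaluation is multiplicative, so comparing powers improves its bound to 1.\<close>

lemma cmod_le_nrm:
  assumes ev: "continuous_map (fun_topology A nrm) euclidean (\<lambda>f. f w)" and f: "f \<in> A"
  shows "cmod (f w) \<le> nrm f"
proof (rule ccontr)
  assume less: "\<not> ?thesis"
  obtain e where e: "\<And>f. f \<in> A \<Longrightarrow> cmod (f w) \<le> e * nrm f" "0 \<le> e"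
    using evaluation_bounded[OF ev] by blast
  have pos: "nrm f > 0"
    using less nrm_nonneg[OF f] nrm_eq_0[OF f] by (cases "nrm f = 0") auto
  define q where "q = cmod (f w) / nrm f"
  have q: "q > 1" using less pos by (simp add: q_def)
  then obtain n where n: "e < q ^ n" using real_arch_pow by blast
  have "cmod (f w) ^ Suc n \<le> e * nrm (\<lambda>z. f z ^ Suc n)"
    using e(1)[OF power_mem[OF f, of n]] by (simp only: norm_power)
  also have "\<dots> \<le> e * nrm f ^ Suc n" using e nrm_power[OF f] by (intro mult_left_mono)
  finally have "q ^ Suc n \<le> e" using pos by (simp add: q_def power_divide field_simps)
  moreover have "q ^ n \<le> q ^ Suc n" using q by (intro power_increasing) auto
  ultimately show False using n by simp
qed

text \<open>The norm of the class of \<open>h\<close> modulo the ideal generated by \<open>f\<close>. Working with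
  functions that are arbitrary off the disc makes the constant function 1 a unit.\<close>

definition ideal_dist :: "(complex \<Rightarrow> complex) \<Rightarrow> (complex \<Rightarrow> complex) \<Rightarrow> real" where
  "ideal_dist f h = (INF k\<in>A. nrm (\<lambda>z. on_disc h z - f z * k z))"

section \<open>The seminorm modulo the ideal generated by \<open>f\<close>\<close>

context
  fixes f assumes f: "f \<in> A"
begin

lemma ideal_diff_mem: "on_disc h \<in> A \<Longrightarrow> k \<in> A \<Longrightarrow> (\<lambda>z. on_disc h z - f z * k z) \<in> A"
  using f by (intro diff_mem mult_mem)

lemma ideal_dist_le:
  "on_disc h \<in> A \<Longrightarrow> k \<in> A \<Longrightarrow> ideal_dist f h \<le> nrm (\<lambda>z. on_disc h z - f z * k z)"
  unfolding ideal_dist_def using nrm_nonneg[OF ideal_diff_mem]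
  by (intro cINF_lower) (auto intro!: bdd_belowI2)

lemma ideal_dist_ge:
  "(\<And>k. k \<in> A \<Longrightarrow> t \<le> nrm (\<lambda>z. on_disc h z - f z * k z)) \<Longrightarrow> t \<le> ideal_dist f h"
  unfolding ideal_dist_def using zero_mem by (intro cINF_greatest) auto

text \<open>Allows the infima over the two factors of a product to be taken one after the other. For
  \<open>a = 0\<close>, where division is impossible, the choice \<open>k = 0\<close>
  suffices.\<close>

lemma le_mult_ideal_dist:
  assumes "0 \<le> a" and le: "\<And>k. k \<in> A \<Longrightarrow> t \<le> a * nrm (\<lambda>z. on_disc h z - f z * k z)"
  shows "t \<le> a * ideal_dist f h"
proof (cases "a = 0")
  case True
  then show ?thesis using le[OF zero_mem] by simp
next
  case False
  then have "t / a \<le> ideal_dist f h"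
    using assms by (intro ideal_dist_ge) (simp add: field_simps)
  then show ?thesis using False assms by (simp add: field_simps)
qed

lemma on_disc_add: "on_disc (x + y) = (\<lambda>z. on_disc x z + on_disc y z)"
  by (auto simp: on_disc_def)

lemma on_disc_mult: "on_disc (x * y) = (\<lambda>z. on_disc x z * on_disc y z)"
  by (auto simp: on_disc_def)

lemma on_disc_scale: "on_disc ((\<lambda>_. a) * x) = (\<lambda>z. a * on_disc x z)"
  by (auto simp: on_disc_def)

lemma ideal_dist_eq_0:
  assumes "k \<in> A" "\<And>z. z \<in> unit_disc \<Longrightarrow> h z = f z * k z"
  shows "ideal_dist f h = 0"
proof -
  have eq: "on_disc h = (\<lambda>z. f z * k z)"
    using assms zero_outside[OF f] by (auto simp: on_disc_def)
  have h: "on_disc h \<in> A" unfolding eq using f assms by (intro mult_mem)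
  have "(\<lambda>z. on_disc h z - f z * k z) = (\<lambda>z. 0)" unfolding eq by simp
  then have "ideal_dist f h \<le> 0"
    using ideal_dist_le[OF h assms(1)] nrm_eq_0[OF zero_mem] by simp
  moreover have "0 \<le> ideal_dist f h"
    using nrm_nonneg[OF ideal_diff_mem[OF h]] by (intro ideal_dist_ge)
  ultimately show ?thesis by simp
qed

lemma seminormed_subalgebra_ideal_dist:
  "seminormed_subalgebra {h. on_disc h \<in> A} (\<lambda>a _. a) (ideal_dist f)"
proof
  show "(\<lambda>_. 1) = (1 :: complex \<Rightarrow> complex)"
    "(\<lambda>_. a + b) = (\<lambda>_. a) + (\<lambda>_. b)" "(\<lambda>_. a * b) = (\<lambda>_. a) * (\<lambda>_. b)"
    for a b :: complex by auto
  show "(\<lambda>_. a) \<in> {h. on_disc h \<in> A}" for a using const_mem by simp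
  fix x y assume "x \<in> {h. on_disc h \<in> A}" "y \<in> {h. on_disc h \<in> A}"
  then have xy: "on_disc x \<in> A" "on_disc y \<in> A" by auto
  have sum: "on_disc (x + y) \<in> A" and prod: "on_disc (x * y) \<in> A"
    unfolding on_disc_add on_disc_mult using xy by (auto intro: add_mem mult_mem)
  then show "x + y \<in> {h. on_disc h \<in> A}" "x * y \<in> {h. on_disc h \<in> A}" by auto
  have le: "ideal_dist f (x + y)
      \<le> nrm (\<lambda>z. on_disc x z - f z * k z) + nrm (\<lambda>z. on_disc y z - f z * l z)"
    if "k \<in> A" "l \<in> A" for k l
  proof -
    have "ideal_dist f (x + y) \<le> nrm (\<lambda>z. on_disc (x + y) z - f z * (k z + l z))"
      using sum that by (intro ideal_dist_le add_mem)
    also have "(\<lambda>z. on_disc (x + y) z - f z * (k z + l z))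
        = (\<lambda>z. (on_disc x z - f z * k z) + (on_disc y z - f z * l z))"
      by (simp add: on_disc_add algebra_simps)
    also have "nrm \<dots> \<le> nrm (\<lambda>z. on_disc x z - f z * k z) + nrm (\<lambda>z. on_disc y z - f z * l z)"
      using xy that by (intro nrm_triangle ideal_diff_mem)
    finally show ?thesis .
  qed
  \<comment> \<open>The infimum is taken over \<open>l\<close> first, with \<open>k\<close> fixed,
    and then over \<open>k\<close>.\<close>
  have "ideal_dist f (x + y) - nrm (\<lambda>z. on_disc x z - f z * k z) \<le> ideal_dist f y" if "k \<in> A" for k
  proof (rule ideal_dist_ge)
    fix l assume "l \<in> A"
    then show "ideal_dist f (x + y) - nrm (\<lambda>z. on_disc x z - f z * k z)
        \<le> nrm (\<lambda>z. on_disc y z - f z * l z)"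
      using le[OF that, of l] by linarith
  qed
  then have "ideal_dist f (x + y) - ideal_dist f y \<le> ideal_dist f x"
    by (intro ideal_dist_ge) (simp add: algebra_simps)
  then show "ideal_dist f (x + y) \<le> ideal_dist f x + ideal_dist f y" by simp
  have mult: "ideal_dist f (x * y)
      \<le> nrm (\<lambda>z. on_disc x z - f z * k z) * nrm (\<lambda>z. on_disc y z - f z * l z)"
    if kl: "k \<in> A" "l \<in> A" for k l
  proof -
    \<comment> \<open>Found by expanding
      \<open>(x - f k) (y - f l) = x y - f (x l + y k - f k l)\<close>.\<close>
    let ?j = "\<lambda>z. (on_disc x z * l z + on_disc y z * k z) - f z * (k z * l z)"
    have "?j \<in> A" using xy kl f by (intro diff_mem add_mem mult_mem)
    then have "ideal_dist f (x * y) \<le> nrm (\<lambda>z. on_disc (x * y) z - f z * ?j z)"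
      using prod by (intro ideal_dist_le)
    also have "(\<lambda>z. on_disc (x * y) z - f z * ?j z)
        = (\<lambda>z. (on_disc x z - f z * k z) * (on_disc y z - f z * l z))"
      by (simp add: on_disc_mult algebra_simps)
    also have "nrm \<dots> \<le> nrm (\<lambda>z. on_disc x z - f z * k z) * nrm (\<lambda>z. on_disc y z - f z * l z)"
      using xy kl by (intro nrm_mult ideal_diff_mem)
    finally show ?thesis .
  qed
  have y0: "0 \<le> ideal_dist f y" and x0: "0 \<le> ideal_dist f x"
    using nrm_nonneg[OF ideal_diff_mem] xy by (auto intro: ideal_dist_ge)
  then show "0 \<le> ideal_dist f x" by simp
  have "ideal_dist f (x * y) \<le> nrm (\<lambda>z. on_disc x z - f z * k z) * ideal_dist f y" if "k \<in> A" for k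
    using nrm_nonneg[OF ideal_diff_mem] xy that mult by (intro le_mult_ideal_dist) auto
  then have "ideal_dist f (x * y) \<le> ideal_dist f y * ideal_dist f x"
    using y0 by (intro le_mult_ideal_dist) (auto simp: mult.commute)
  then show "ideal_dist f (x * y) \<le> ideal_dist f x * ideal_dist f y" by (simp add: mult.commute)
  show "ideal_dist f ((\<lambda>_. a) * x) \<le> cmod a * ideal_dist f x" for a
  proof (rule le_mult_ideal_dist)
    fix k assume k: "k \<in> A"
    have "on_disc ((\<lambda>_. a) * x) \<in> A" unfolding on_disc_scale by (rule scale_mem[OF xy(1)])
    then have "ideal_dist f ((\<lambda>_. a) * x) \<le> nrm (\<lambda>z. on_disc ((\<lambda>_. a) * x) z - f z * (a * k z))"
      using scale_mem[OF k] by (intro ideal_dist_le)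
    also have "(\<lambda>z. on_disc ((\<lambda>_. a) * x) z - f z * (a * k z))
        = (\<lambda>z. a * (on_disc x z - f z * k z))"
      by (simp only: on_disc_scale) (simp add: algebra_simps)
    also have "nrm \<dots> = cmod a * nrm (\<lambda>z. on_disc x z - f z * k z)"
      using xy k by (intro nrm_scale ideal_diff_mem)
    finally show "ideal_dist f ((\<lambda>_. a) * x) \<le> cmod a * nrm (\<lambda>z. on_disc x z - f z * k z)" .
  qed simp
qed

lemma ideal_dist_le_nrm: "h \<in> A \<Longrightarrow> ideal_dist f h \<le> nrm h"
  using ideal_dist_le[of h "\<lambda>z. 0"] zero_mem by (simp add: on_disc_id)

lemma ideal_dist_approx:
  assumes "h \<in> A" "ideal_dist f h = 0" "\<epsilon> > 0"
  obtains k where "k \<in> A" "nrm (\<lambda>z. h z - f z * k z) < \<epsilon>"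
  using assms ideal_dist_ge[of \<epsilon> h] by (force simp: on_disc_id not_less)

end

section \<open>The corona estimate and the resolvent of \<open>g\<close>\<close>

definition corona_property :: "real \<Rightarrow> real \<Rightarrow> bool" where
  "corona_property C a \<longleftrightarrow> (\<forall>\<delta>>0. \<forall>f1\<in>A. \<forall>f2\<in>A.
    (\<forall>z\<in>unit_disc. \<delta> \<le> cmod (f1 z) + cmod (f2 z) \<and> cmod (f1 z) + cmod (f2 z) \<le> 1) \<longrightarrow>
    (\<exists>g1\<in>A. \<exists>g2\<in>A. (\<forall>z\<in>unit_disc. f1 z * g1 z + f2 z * g2 z = 1) \<and>
      nrm g1 \<le> C / \<delta> powr a \<and> nrm g2 \<le> C / \<delta> powr a))"

text \<open>Where \<open>1 - l g\<close> is small, \<open>g\<close> and hence \<open>f\<close> is of size at least a constant times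
  \<open>1 / \<bar>l\<bar>\<close>. So \<open>1 - l g\<close> is invertible modulo \<open>f\<close>, with polynomial growth in \<open>l\<close>.\<close>

lemma corona_resolvent:
  assumes C: "C > 0" "a \<ge> 0" and corona: "corona_property C a"
    and ev: "\<And>w. w \<in> unit_disc \<Longrightarrow> continuous_map (fun_topology A nrm) euclidean (\<lambda>f. f w)"
    and f: "f \<in> A" and g: "g \<in> A" and dom: "\<And>z. z \<in> unit_disc \<Longrightarrow> cmod (g z) \<le> cmod (f z)"
  shows "\<exists>B. \<forall>l. \<exists>u\<in>A. \<exists>v\<in>A. (\<forall>z\<in>unit_disc. (1 - l * g z) * u z + f z * v z = 1)
    \<and> nrm u \<le> B * (1 + cmod l) ^ nat \<lceil>a\<rceil>"
proof -
  \<comment> \<open>By \<open>cmod_le_nrm\<close>, \<open>1 + |f| + |g| \<le> K\<close> on the disc;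
    dividing by \<open>K\<close> yields the upper bound 1 in the corona hypothesis.\<close>
  define K where "K = 1 + nrm f + nrm g"
  have K: "K \<ge> 1" using nrm_nonneg f g by (simp add: K_def)
  have "\<exists>u\<in>A. \<exists>v\<in>A. (\<forall>z\<in>unit_disc. (1 - l * g z) * u z + f z * v z = 1)
      \<and> nrm u \<le> C * (2 * K) ^ nat \<lceil>a\<rceil> * (1 + cmod l) ^ nat \<lceil>a\<rceil>" for l
  proof -
    define D where "D = 1 + cmod l"
    have D: "D \<ge> 1" "cmod l \<le> D" by (auto simp: D_def)
    have KD: "K * D \<ge> 1" using K D mult_mono[of 1 K 1 D] by simp
    define f1 where "f1 z = of_real (1 / (K * D)) * (on_disc (\<lambda>_. 1) z - l * g z)" for z
    define f2 where "f2 z = of_real (1 / K) * f z" for z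
    \<comment> \<open>Either \<open>|1 - l g| \<ge> 1 / 2\<close>, or
      \<open>|l g| \<ge> 1 / 2\<close> and then \<open>|f| \<ge> 1 / (2 D)\<close>; in both cases
      \<open>f1\<close> or \<open>f2\<close> has modulus at least
      \<open>1 / (2 K D)\<close>.\<close>
    define \<delta> where "\<delta> = 1 / (2 * K * D)"
    have \<delta>: "\<delta> > 0" using K D by (simp add: \<delta>_def)
    have f1A: "f1 \<in> A" and f2A: "f2 \<in> A"
      unfolding f1_def[abs_def] f2_def[abs_def] using one_mem f g by (intro scale_mem diff_mem; simp)+
    have bounds: "\<delta> \<le> cmod (f1 z) + cmod (f2 z) \<and> cmod (f1 z) + cmod (f2 z) \<le> 1"
      if z: "z \<in> unit_disc" for z
    proof
      have fz: "cmod (f z) \<le> nrm f" and gz: "cmod (g z) \<le> nrm g"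
        using cmod_le_nrm[OF ev[OF z]] f g by auto
      have "f1 z = (1 - l * g z) / of_real (K * D)"
        using z by (simp add: f1_def on_disc_def)
      then have c1: "cmod (f1 z) = cmod (1 - l * g z) / (K * D)"
        using KD by (simp only: norm_divide norm_of_real)
      have c2: "cmod (f2 z) = cmod (f z) / K"
        using K by (simp add: f2_def norm_divide)
      have "cmod (1 - l * g z) \<le> 1 + cmod l * cmod (g z)"
        using norm_triangle_ineq4[of 1 "l * g z"] by (simp add: norm_mult)
      also have "\<dots> \<le> D * 1 + D * nrm g"
        using D gz by (intro add_mono mult_mono) auto
      also have "\<dots> = (1 + nrm g) * D" by (simp add: algebra_simps)
      finally have "cmod (f1 z) \<le> (1 + nrm g) * D / (K * D)"
        unfolding c1 using K D by (intro divide_right_mono) auto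
      also have "\<dots> = (1 + nrm g) / K" using D by simp
      finally have "cmod (f1 z) \<le> (1 + nrm g) / K" .
      moreover have "cmod (f2 z) \<le> nrm f / K"
        unfolding c2 using fz K by (intro divide_right_mono) auto
      moreover have "(1 + nrm g) / K + nrm f / K = 1"
      proof -
        have "(1 + nrm g) / K + nrm f / K = (1 + nrm g + nrm f) / K"
          by (simp only: add_divide_distrib)
        also have "1 + nrm g + nrm f = K" by (simp only: K_def add_ac)
        also have "K / K = 1" using K by simp
        finally show ?thesis .
      qed
      ultimately show "cmod (f1 z) + cmod (f2 z) \<le> 1" by linarith
      show "\<delta> \<le> cmod (f1 z) + cmod (f2 z)"
      proof (cases "cmod (1 - l * g z) \<ge> 1 / 2")
        case True
        then have "1 / 2 / (K * D) \<le> cmod (f1 z)"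
          unfolding c1 using K D by (intro divide_right_mono) auto
        then show ?thesis by (simp add: \<delta>_def add_increasing2)
      next
        case False
        have "1 \<le> cmod (1 - l * g z) + cmod (l * g z)"
          using norm_triangle_ineq[of "1 - l * g z" "l * g z"] by simp
        then have "1 / 2 \<le> cmod l * cmod (g z)" using False by (simp add: norm_mult)
        also have "\<dots> \<le> D * cmod (f z)"
          using D dom[OF z] by (intro mult_mono) auto
        finally have "1 / 2 / (K * D) \<le> D * cmod (f z) / (K * D)"
          using K D by (intro divide_right_mono) auto
        then have "\<delta> \<le> cmod (f2 z)"
          unfolding c2 \<delta>_def using D by simp
        then show ?thesis by (simp add: add_increasing)
      qed
    qed
    obtain g1 g2 where gs: "g1 \<in> A" "g2 \<in> A"
        "\<And>z. z \<in> unit_disc \<Longrightarrow> f1 z * g1 z + f2 z * g2 z = 1" "nrm g1 \<le> C / \<delta> powr a"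
      using corona[unfolded corona_property_def, rule_format, OF \<delta> f1A f2A bounds] by metis
    \<comment> \<open>The scaling factors of \<open>f1\<close> and \<open>f2\<close> are moved into
      the Bezout solutions.\<close>
    let ?u = "\<lambda>z. of_real (1 / (K * D)) * g1 z" and ?v = "\<lambda>z. of_real (1 / K) * g2 z"
    have u: "?u \<in> A" and v: "?v \<in> A" using gs by (intro scale_mem; simp)+
    have inv: "(1 - l * g z) * ?u z + f z * ?v z = 1" if "z \<in> unit_disc" for z
    proof -
      have "f1 z = of_real (1 / (K * D)) * (1 - l * g z)"
        using that by (simp only: f1_def on_disc_def if_True)
      then show ?thesis using gs(3)[OF that] by (simp only: f2_def mult_ac)
    qed
    have "nrm ?u \<le> C * (2 * K) ^ nat \<lceil>a\<rceil> * D ^ nat \<lceil>a\<rceil>"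
    proof -
      have "nrm ?u = 1 / (K * D) * nrm g1"
        using nrm_scale[OF gs(1), of "of_real (1 / (K * D))"] KD
        by (simp only: norm_of_real) simp
      also have "\<dots> \<le> 1 * nrm g1"
        using KD nrm_nonneg[OF gs(1)] by (intro mult_right_mono) auto
      also have "\<dots> \<le> C * (2 * K * D) powr a"
        using gs(4) K D by (simp add: \<delta>_def powr_divide)
      \<comment> \<open>The base is at least 1, so the real exponent may be rounded up to a natural
        number.\<close>
      also have "(2 * K * D) powr a \<le> (2 * K * D) powr real (nat \<lceil>a\<rceil>)"
        using KD by (intro powr_mono) linarith+
      also have "\<dots> = (2 * K) ^ nat \<lceil>a\<rceil> * D ^ nat \<lceil>a\<rceil>"
        using K D by (simp add: powr_realpow power_mult_distrib)
      finally show ?thesis using C by (simp add: mult_ac)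
    qed
    then have "nrm ?u \<le> C * (2 * K) ^ nat \<lceil>a\<rceil> * (1 + cmod l) ^ nat \<lceil>a\<rceil>"
      by (simp only: D_def)
    then show ?thesis
      by (intro bexI[OF _ u] bexI[OF _ v] conjI ballI inv)
  qed
  then show ?thesis by blast
qed

text \<open>Liouville's argument in the seminorm modulo \<open>f A\<close>. The exponent exceeds the
  growth degree by one and depends on neither \<open>f\<close> nor \<open>g\<close>.\<close>

lemma power_mem_closure_ideal:
  assumes C: "C > 0" "a \<ge> 0" and corona: "corona_property C a"
    and ev: "\<And>w. w \<in> unit_disc \<Longrightarrow> continuous_map (fun_topology A nrm) euclidean (\<lambda>f. f w)"
    and f: "f \<in> A" and g: "g \<in> A" and dom: "\<And>z. z \<in> unit_disc \<Longrightarrow> cmod (g z) \<le> cmod (f z)"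
    and \<epsilon>: "\<epsilon> > 0"
  obtains k where "k \<in> A" "nrm (\<lambda>z. g z ^ Suc (nat \<lceil>a\<rceil>) - f z * k z) < \<epsilon>"
proof -
  interpret Q: seminormed_subalgebra "{h. on_disc h \<in> A}" "\<lambda>a _. a" "ideal_dist f"
    by (rule seminormed_subalgebra_ideal_dist[OF f])
  obtain B where "\<forall>l. \<exists>u\<in>A. \<exists>v\<in>A. (\<forall>z\<in>unit_disc. (1 - l * g z) * u z + f z * v z = 1)
      \<and> nrm u \<le> B * (1 + cmod l) ^ nat \<lceil>a\<rceil>"
    using corona_resolvent[OF C corona ev f g dom] by blast
  then obtain u v where uv: "\<And>l. u l \<in> A" "\<And>l. v l \<in> A"
      "\<And>l z. z \<in> unit_disc \<Longrightarrow> (1 - l * g z) * u l z + f z * v l z = 1"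
      "\<And>l. nrm (u l) \<le> B * (1 + cmod l) ^ nat \<lceil>a\<rceil>"
    by metis
  have "ideal_dist f (g ^ Suc (nat \<lceil>a\<rceil>)) = 0"
  proof (rule Q.nilpotent_of_polynomial_resolvent[where u = u and B = B])
    \<comment> \<open>The second Bezout solution \<open>v l\<close> exhibits the inversion error as
      a multiple of \<open>f\<close>.\<close>
    show "ideal_dist f (1 - (1 - (\<lambda>_. l) * g) * u l) = 0" for l
    proof (rule ideal_dist_eq_0[OF f uv(2)])
      show "(1 - (1 - (\<lambda>_. l) * g) * u l) z = f z * v l z" if "z \<in> unit_disc" for z
        using uv(3)[OF that, of l] by (simp add: algebra_simps)
    qed
    show "ideal_dist f (u l) \<le> B * (1 + cmod l) ^ nat \<lceil>a\<rceil>" for l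
      using ideal_dist_le_nrm[OF f uv(1)] uv(4) by (rule order.trans)
  qed (use g uv(1) on_disc_id in auto)
  moreover have "g ^ Suc (nat \<lceil>a\<rceil>) = (\<lambda>z. g z ^ Suc (nat \<lceil>a\<rceil>))"
    by (rule ext) (rule power_fun_apply)
  ultimately have "ideal_dist f (\<lambda>z. g z ^ Suc (nat \<lceil>a\<rceil>)) = 0" by (simp only:)
  from ideal_dist_approx[OF f power_mem[OF g] this \<epsilon>] that show thesis by blast
qed

end

section \<open>Passage from the algebra to closed invariant subspaces of \<open>X\<close>\<close>

theorem theorem1:
  fixes X A :: "(complex \<Rightarrow> complex) set"
    and nX nA :: "(complex \<Rightarrow> complex) \<Rightarrow> real"
  assumes X_banach: "disc_banach_space X nX"
    and X_analytic: "\<And>f. f \<in> X \<Longrightarrow> f holomorphic_on unit_disc"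
    and X_eval: "\<And>w. w \<in> unit_disc \<Longrightarrow> continuous_map (fun_topology X nX) euclidean (\<lambda>f. f w)"
    and X_shift: "\<And>f. f \<in> X \<Longrightarrow> (\<lambda>z. z * f z) \<in> X"
    and polys_subset: "disc_polys \<subseteq> X"
    and polys_dense: "fun_topology X nX closure_of disc_polys = X"
    and A_banach_algebra: "disc_banach_algebra A nA"
    and A_multipliers: "A \<subseteq> multipliers X"
    and A_eval: "\<And>w. w \<in> unit_disc \<Longrightarrow> continuous_map (fun_topology A nA) euclidean (\<lambda>f. f w)"
    and corona: "\<exists>C a :: real. C > 0 \<and> a \<ge> 1 \<and>
      (\<forall>\<delta>>0. \<forall>f1\<in>A. \<forall>f2\<in>A.
        (\<forall>z\<in>unit_disc. \<delta> \<le> cmod (f1 z) + cmod (f2 z) \<and> cmod (f1 z) + cmod (f2 z) \<le> 1) \<longrightarrow>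
        (\<exists>g1\<in>A. \<exists>g2\<in>A. (\<forall>z\<in>unit_disc. f1 z * g1 z + f2 z * g2 z = 1) \<and>
          nA g1 \<le> C / \<delta> powr a \<and> nA g2 \<le> C / \<delta> powr a))"
  shows "\<exists>N::nat. N \<ge> 1 \<and> (\<forall>f\<in>A. \<forall>g\<in>A. (\<forall>z\<in>unit_disc. cmod (g z) \<le> cmod (f z)) \<longrightarrow>
    shift_invariant_span X nX (\<lambda>z. g z ^ N) \<subseteq> shift_invariant_span X nX f)"
proof -
  interpret X: disc_banach_space X nX by fact
  interpret A: disc_banach_algebra A nA by fact
  obtain C a where C: "C > 0" "a \<ge> 1" and cor: "A.corona_property C a"
    using corona unfolding A.corona_property_def by blast
  have a0: "a \<ge> 0" using C(2) by simp
  have mult: "(\<lambda>z. h z * q z) \<in> X" if "h \<in> A" "q \<in> X" for h q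
    using A_multipliers that by (auto simp: multipliers_def)
  \<comment> \<open>\<open>N\<close> depends on the corona exponent alone, so one choice serves all
    pairs \<open>f\<close>, \<open>g\<close>.\<close>
  define N where "N = Suc (nat \<lceil>a\<rceil>)"
  have "shift_invariant_span X nX (\<lambda>z. g z ^ N) \<subseteq> shift_invariant_span X nX f"
    if f: "f \<in> A" and g: "g \<in> A" and dom: "\<And>z. z \<in> unit_disc \<Longrightarrow> cmod (g z) \<le> cmod (f z)" for f g
    unfolding shift_invariant_span_def
  \<comment> \<open>The target is closed, so it is enough to approximate each \<open>p g ^ N\<close>
    by polynomial multiples of \<open>f\<close>.\<close>
  proof (rule closure_of_minimal)
    show "closedin (fun_topology X nX)
        (fun_topology X nX closure_of {\<lambda>z. p z * f z |p. p \<in> disc_polys})" by simp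
    obtain K where K: "K > 0" "\<And>h. h \<in> X \<Longrightarrow> nX (\<lambda>z. f z * h z) \<le> K * nX h"
      using multiplication_operator_bounded[OF X_banach X_banach X_eval X_eval mult[OF f]] by blast
    have gN: "(\<lambda>z. g z ^ N) \<in> A" unfolding N_def by (rule A.power_mem[OF g])
    have "(\<lambda>z. p z * g z ^ N) \<in> fun_topology X nX closure_of {\<lambda>z. p z * f z |p. p \<in> disc_polys}"
      if p: "p \<in> disc_polys" for p
      unfolding X.mem_closure_iff
    proof (intro conjI allI impI)
      have pX: "p \<in> X" using p polys_subset by blast
      have pmult: "(\<lambda>z. p z * h z) \<in> X" if "h \<in> A" for h
        using mult[OF that pX] by (simp add: mult.commute)
      show pg: "(\<lambda>z. p z * g z ^ N) \<in> X" using pmult[OF gN] .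
      \<comment> \<open>Elements of \<open>A\<close> are multipliers, so multiplication by
        \<open>p\<close> maps \<open>A\<close> into \<open>X\<close>; its boundedness carries
        closeness in \<open>A\<close> over to \<open>X\<close>.\<close>
      obtain M where M: "M > 0" "\<And>h. h \<in> A \<Longrightarrow> nX (\<lambda>z. p z * h z) \<le> M * nA h"
        using multiplication_operator_bounded[OF A.disc_banach_space_axioms X_banach A_eval X_eval pmult]
        by blast
      fix \<epsilon> :: real assume \<epsilon>: "\<epsilon> > 0"
      then have "\<epsilon> / (2 * M) > 0" using M by simp
      then obtain k where k: "k \<in> A" "nA (\<lambda>z. g z ^ N - f z * k z) < \<epsilon> / (2 * M)"
        using A.power_mem_closure_ideal[OF C(1) a0 cor A_eval f g dom] unfolding N_def by blast
      \<comment> \<open>The cofactor \<open>k\<close> need not be a polynomial, but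
        \<open>p k\<close> lies in \<open>X\<close>, where density supplies a polynomial
        \<open>q\<close> near it.\<close>
      have pk: "(\<lambda>z. p z * k z) \<in> X" by (rule pmult[OF k(1)])
      then have "(\<lambda>z. p z * k z) \<in> fun_topology X nX closure_of disc_polys"
        using polys_dense by simp
      moreover have "\<epsilon> / (2 * K) > 0" using \<epsilon> K by simp
      ultimately obtain q where q: "q \<in> disc_polys" "nX (\<lambda>z. p z * k z - q z) < \<epsilon> / (2 * K)"
        unfolding X.mem_closure_iff by blast
      have qX: "q \<in> X" using q polys_subset by blast
      have fq: "(\<lambda>z. q z * f z) \<in> X" using mult[OF f qX] by (simp add: mult.commute)
      let ?s = "\<lambda>z. g z ^ N - f z * k z" and ?t = "\<lambda>z. p z * k z - q z"
      have s: "?s \<in> A" using gN f k by (intro A.diff_mem A.mult_mem)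
      have t: "?t \<in> X" using pk qX by (rule X.diff_mem)
      \<comment> \<open>The first error is small in \<open>A\<close> and is controlled by
        \<open>M\<close>, the second is small in \<open>X\<close> and is controlled by
        \<open>K\<close>; each contributes less than half of the tolerance.\<close>
      have eq: "(\<lambda>z. p z * g z ^ N - q z * f z) = (\<lambda>z. p z * ?s z + f z * ?t z)"
        by (simp add: algebra_simps)
      have "nX (\<lambda>z. p z * g z ^ N - q z * f z) \<le> nX (\<lambda>z. p z * ?s z) + nX (\<lambda>z. f z * ?t z)"
        unfolding eq by (rule X.nrm_triangle[OF pmult[OF s] mult[OF f t]])
      also have "\<dots> \<le> M * nA ?s + K * nX ?t" by (rule add_mono[OF M(2)[OF s] K(2)[OF t]])
      also have "\<dots> < M * (\<epsilon> / (2 * M)) + K * (\<epsilon> / (2 * K))"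
        by (rule add_strict_mono[OF mult_strict_left_mono[OF k(2) M(1)]
              mult_strict_left_mono[OF q(2) K(1)]])
      also have "\<dots> = \<epsilon>" using M(1) K(1) by simp
      finally have "nX (\<lambda>z. p z * g z ^ N - q z * f z) < \<epsilon>" .
      then show "\<exists>h\<in>{\<lambda>z. p z * f z |p. p \<in> disc_polys}. h \<in> X \<and> nX (\<lambda>z. p z * g z ^ N - h z) < \<epsilon>"
        using q(1) fq by (intro bexI[of _ "\<lambda>z. q z * f z"]) auto
    qed
    then show "{\<lambda>z. p z * g z ^ N |p. p \<in> disc_polys}
        \<subseteq> fun_topology X nX closure_of {\<lambda>z. p z * f z |p. p \<in> disc_polys}" by blast
  qed
  moreover have "N \<ge> 1" by (simp add: N_def)
  ultimately show ?thesis by blast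
qed

end
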